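(* Let $(R,\mathfrak m,k)$ be a commutative Noetherian local ring and let $M$ be a nonzero finitely generated $R\ltimes k$-module. If $\operatorname{Ext}_{R\ltimes k}^{i}(M,M\oplus (R\ltimes k))=0$ for some $i\geq 3$, then $M$ is a free $R\ltimes k$-module.
   Context: For a commutative ring $R$ and an $R$-module $L$, the idealization $R\ltimes L$ is the commutative ring whose additive group is $R\oplus L$, with identity $(1,0)$ and multiplication $(r_1,l_1)(r_2,l_2)=(r_1r_2,\,r_1l_2+r_2l_1)$. If $(R,\mathfrak m,k)$ is Noetherian local and $L$ is finitely generated, then $R\ltimes L$ is a Noetherian local ring with maximal ideal $\mathfrak m\ltimes L$ and residue field $k$. Here $k=R/\mathfrak m$ is regarded as an $R$-module. *)

theory Defs
  imports
    "HOL-Algebra.QuotRing"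
    "HOL-Algebra.Ring_Divisibility"
    "HOL-Algebra.Elementary_Groups"
    "HOL-Library.FSet"
    "Jordan_Normal_Form.Missing_VectorSpace"
begin

section \<open>Local rings, residue fields and idealizations\<close>

locale noetherian_local_ring = noetherian_ring R + cring R + maximalideal \<mm> R
  for R (structure) and \<mm> +
  assumes maximalideal_unique: "maximalideal J R \<Longrightarrow> J = \<mm>"

definition regular_module :: "('a, 'c) ring_scheme \<Rightarrow> ('a, 'a) module" where
  "regular_module R =
    \<lparr>carrier = carrier R, monoid.mult = monoid.mult R, monoid.one = monoid.one R,
     ring.zero = ring.zero R, ring.add = ring.add R, smult = monoid.mult R\<rparr>"

definition quotient_ring_module :: "('a, 'c) ring_scheme \<Rightarrow> 'a set \<Rightarrow> ('a, 'a set) module" where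
  "quotient_ring_module R I =
    ring.extend (R Quot I) (module.fields (\<lambda>r c. (I +>\<^bsub>R\<^esub> r) \<otimes>\<^bsub>R Quot I\<^esub> c))"

definition idealization ::
  "('a, 'c) ring_scheme \<Rightarrow> ('a, 'b, 'd) module_scheme \<Rightarrow> ('a \<times> 'b) ring" (infixl \<open>\<ltimes>\<close> 65) where
  "R \<ltimes> L =
    \<lparr>carrier = carrier R \<times> carrier L,
     monoid.mult = (\<lambda>(r, x) (s, y). (r \<otimes>\<^bsub>R\<^esub> s, r \<odot>\<^bsub>L\<^esub> y \<oplus>\<^bsub>L\<^esub> s \<odot>\<^bsub>L\<^esub> x)),
     monoid.one = (\<one>\<^bsub>R\<^esub>, \<zero>\<^bsub>L\<^esub>),
     ring.zero = (\<zero>\<^bsub>R\<^esub>, \<zero>\<^bsub>L\<^esub>),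
     ring.add = (\<lambda>(r, x) (s, y). (r \<oplus>\<^bsub>R\<^esub> s, x \<oplus>\<^bsub>L\<^esub> y))\<rparr>"


section \<open>Finitely generated and free modules\<close>

definition fin_gen_module :: "('a, 'c) ring_scheme \<Rightarrow> ('a, 'm, 'd) module_scheme \<Rightarrow> bool" where
  "fin_gen_module R M \<longleftrightarrow>
    module R M \<and> (\<exists>A \<subseteq> carrier M. finite A \<and> module.span R M A = carrier M)"

definition free_module :: "('a, 'c) ring_scheme \<Rightarrow> ('a, 'm, 'd) module_scheme \<Rightarrow> bool" where
  "free_module R M \<longleftrightarrow>
    module R M \<and>
    (\<exists>B \<subseteq> carrier M. \<not> module.lin_dep R M B \<and> module.span R M B = carrier M)"


section \<open>Ext\<close>

subsection \<open>The free module on a set\<close>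

text \<open>Finitely supported functions on \<open>X\<close>, extended by zero to the whole type. The multiplicative
  fields of the record carry no information.\<close>

definition free_on :: "('a, 'c) ring_scheme \<Rightarrow> 'x set \<Rightarrow> ('a, 'x \<Rightarrow> 'a) module" where
  "free_on R X =
    \<lparr>carrier = {f. (\<forall>x. f x \<in> carrier R) \<and> finite {x. f x \<noteq> \<zero>\<^bsub>R\<^esub>} \<and> {x. f x \<noteq> \<zero>\<^bsub>R\<^esub>} \<subseteq> X},
     monoid.mult = (\<lambda>f g x. \<zero>\<^bsub>R\<^esub>), monoid.one = (\<lambda>x. \<zero>\<^bsub>R\<^esub>),
     ring.zero = (\<lambda>x. \<zero>\<^bsub>R\<^esub>),
     ring.add = (\<lambda>f g x. f x \<oplus>\<^bsub>R\<^esub> g x),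
     smult = (\<lambda>r f x. r \<otimes>\<^bsub>R\<^esub> f x)\<rparr>"


subsection \<open>The standard free resolution\<close>

text \<open>
  Every module \<open>M\<close> has the functorial free resolution
  \<open>\<dots> \<rightarrow> F\<^sub>2 \<rightarrow> F\<^sub>1 \<rightarrow> F\<^sub>0 \<rightarrow> M \<rightarrow> 0\<close> in which \<open>F\<^sub>0\<close> is free on the set \<open>M\<close> and \<open>F\<^sub>n\<^sub>+\<^sub>1\<close> is free on the
  set of elements of the kernel of the map leaving \<open>F\<^sub>n\<close>; each basis element is sent to the element
  that it names. In order that all \<open>F\<^sub>n\<close> have elements of one type, the basis elements are taken from
  the following datatype: \<open>Gen m\<close> names \<open>m \<in> M\<close>, and \<open>Syz S\<close> names the finitely supported function
  whose nonzero values form the graph \<open>S\<close>.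
\<close>

datatype ('a, 'm) res_basis =
  Gen (gen_elem: 'm)
| Syz (syz_graph: "(('a, 'm) res_basis \<times> 'a) fset")

definition syz_name ::
  "('a, 'c) ring_scheme \<Rightarrow> (('a, 'm) res_basis \<Rightarrow> 'a) \<Rightarrow> ('a, 'm) res_basis" where
  "syz_name R f = Syz (Abs_fset {(x, f x) | x. f x \<noteq> \<zero>\<^bsub>R\<^esub>})"

definition syz_elem ::
  "('a, 'c) ring_scheme \<Rightarrow> ('a, 'm) res_basis \<Rightarrow> ('a, 'm) res_basis \<Rightarrow> 'a" where
  "syz_elem R b =
    (\<lambda>x. if \<exists>r. (x, r) \<in> fset (syz_graph b) then THE r. (x, r) \<in> fset (syz_graph b) else \<zero>\<^bsub>R\<^esub>)"

definition res_aug ::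
  "('a, 'c) ring_scheme \<Rightarrow> ('a, 'm, 'd) module_scheme \<Rightarrow> (('a, 'm) res_basis \<Rightarrow> 'a) \<Rightarrow> 'm" where
  "res_aug R M f = (\<Oplus>\<^bsub>M\<^esub>b\<in>{b. f b \<noteq> \<zero>\<^bsub>R\<^esub>}. f b \<odot>\<^bsub>M\<^esub> gen_elem b)"

text \<open>One formula serves for all the maps \<open>F\<^sub>n\<^sub>+\<^sub>1 \<rightarrow> F\<^sub>n\<close>.\<close>

definition res_diff ::
  "('a, 'c) ring_scheme \<Rightarrow> (('a, 'm) res_basis \<Rightarrow> 'a) \<Rightarrow> (('a, 'm) res_basis \<Rightarrow> 'a)" where
  "res_diff R f = (\<lambda>x. \<Oplus>\<^bsub>R\<^esub>b\<in>{b. f b \<noteq> \<zero>\<^bsub>R\<^esub>}. f b \<otimes>\<^bsub>R\<^esub> syz_elem R b x)"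

primrec res_basis_set ::
  "('a, 'c) ring_scheme \<Rightarrow> ('a, 'm, 'd) module_scheme \<Rightarrow> nat \<Rightarrow> ('a, 'm) res_basis set" where
  "res_basis_set R M 0 = Gen ` carrier M"
| "res_basis_set R M (Suc n) =
    syz_name R ` {f \<in> carrier (free_on R (res_basis_set R M n)).
      (case n of 0 \<Rightarrow> res_aug R M f = \<zero>\<^bsub>M\<^esub> | Suc _ \<Rightarrow> res_diff R f = (\<lambda>x. \<zero>\<^bsub>R\<^esub>))}"

definition res_mod ::
  "('a, 'c) ring_scheme \<Rightarrow> ('a, 'm, 'd) module_scheme \<Rightarrow> nat \<Rightarrow>
    ('a, ('a, 'm) res_basis \<Rightarrow> 'a) module" where
  "res_mod R M n = free_on R (res_basis_set R M n)"


subsection \<open>Cohomology of the Hom complex\<close>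

text \<open>Homomorphisms are taken extensional so that equality in the group is equality on the
  domain.\<close>

definition hom_group ::
  "('a, 'c) ring_scheme \<Rightarrow> ('a, 'p, 'd) module_scheme \<Rightarrow> ('a, 'n, 'e) module_scheme \<Rightarrow>
    ('p \<Rightarrow> 'n) monoid" where
  "hom_group R P N =
    \<lparr>carrier = module_hom R P N \<inter> extensional (carrier P),
     monoid.mult = (\<lambda>f g. \<lambda>x\<in>carrier P. f x \<oplus>\<^bsub>N\<^esub> g x),
     monoid.one = (\<lambda>x\<in>carrier P. \<zero>\<^bsub>N\<^esub>)\<rparr>"

definition cocycles ::
  "('a, 'c) ring_scheme \<Rightarrow> (nat \<Rightarrow> ('a, 'p) module) \<Rightarrow> (nat \<Rightarrow> 'p \<Rightarrow> 'p) \<Rightarrow>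
    ('a, 'n, 'e) module_scheme \<Rightarrow> nat \<Rightarrow> ('p \<Rightarrow> 'n) set" where
  "cocycles R P d N i =
    {f \<in> carrier (hom_group R (P i) N). \<forall>x \<in> carrier (P (Suc i)). f (d i x) = \<zero>\<^bsub>N\<^esub>}"

definition coboundaries ::
  "('a, 'c) ring_scheme \<Rightarrow> (nat \<Rightarrow> ('a, 'p) module) \<Rightarrow> (nat \<Rightarrow> 'p \<Rightarrow> 'p) \<Rightarrow>
    ('a, 'n, 'e) module_scheme \<Rightarrow> nat \<Rightarrow> ('p \<Rightarrow> 'n) set" where
  "coboundaries R P d N i =
    (case i of
      0 \<Rightarrow> {\<one>\<^bsub>hom_group R (P 0) N\<^esub>}
    | Suc j \<Rightarrow> (\<lambda>g. \<lambda>x\<in>carrier (P (Suc j)). g (d j x)) ` carrier (hom_group R (P j) N))"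

definition hom_cohomology ::
  "('a, 'c) ring_scheme \<Rightarrow> (nat \<Rightarrow> ('a, 'p) module) \<Rightarrow> (nat \<Rightarrow> 'p \<Rightarrow> 'p) \<Rightarrow>
    ('a, 'n, 'e) module_scheme \<Rightarrow> nat \<Rightarrow> ('p \<Rightarrow> 'n) set monoid" where
  "hom_cohomology R P d N i =
    (hom_group R (P i) N)\<lparr>carrier := cocycles R P d N i\<rparr> Mod coboundaries R P d N i"

text \<open>The abelian group \<open>Ext\<^sup>i(M, N)\<close>.\<close>

definition Ext ::
  "('a, 'c) ring_scheme \<Rightarrow> nat \<Rightarrow> ('a, 'm, 'd) module_scheme \<Rightarrow> ('a, 'n, 'e) module_scheme \<Rightarrow>
    ((('a, 'm) res_basis \<Rightarrow> 'a) \<Rightarrow> 'n) set monoid" where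
  "Ext R i M N = hom_cohomology R (res_mod R M) (\<lambda>_. res_diff R) N i"

section \<open>Consistency of the definitions\<close>

lemma regular_module_module:
  fixes R (structure)
  assumes "cring R"
  shows "module R (regular_module R)"
proof -
  interpret cring R by fact
  have "abelian_group (regular_module R)"
    by (rule abelian_groupI) (auto simp: regular_module_def a_ac intro: l_neg a_inv_closed)
  then show ?thesis
    by (intro moduleI assms) (auto simp: regular_module_def l_distr r_distr m_assoc)
qed

lemma quotient_ring_module_module:
  fixes R (structure)
  assumes "cring R" "ideal I R"
  shows "module R (quotient_ring_module R I)"
proof -
  interpret cring R by fact
  interpret ideal I R by fact
  interpret Q: cring "R Quot I" by (rule quotient_is_cring[OF assms(1)])
  have h: "(+>) I \<in> ring_hom R (R Quot I)" by (rule rcos_ring_hom)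
  have c: "r \<in> carrier R \<Longrightarrow> I +> r \<in> carrier (R Quot I)" for r
    using ring_hom_closed[OF h] by blast
  have [simp]: "carrier (quotient_ring_module R I) = carrier (R Quot I)"
    "ring.add (quotient_ring_module R I) = ring.add (R Quot I)"
    "ring.zero (quotient_ring_module R I) = ring.zero (R Quot I)"
    "smult (quotient_ring_module R I) = (\<lambda>r c. (I +> r) \<otimes>\<^bsub>R Quot I\<^esub> c)"
    by (simp_all add: quotient_ring_module_def ring.defs module.defs)
  show ?thesis
  proof (rule moduleI[OF assms(1)])
    show "abelian_group (quotient_ring_module R I)"
      by (rule abelian_groupI) (auto simp: Q.a_ac intro: Q.l_neg Q.a_inv_closed)
  qed (auto simp: c ring_hom_add[OF h] ring_hom_mult[OF h] ring_hom_one[OF h] Q.l_distr Q.r_distr Q.m_assoc)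
qed

lemma idealization_cring:
  assumes "module R L"
  shows "cring (R \<ltimes> L)"
proof -
  interpret module R L by fact
  show ?thesis
  proof (rule cringI)
    show "abelian_group (R \<ltimes> L)"
      by (rule abelian_groupI)
        (auto simp: idealization_def R.a_ac M.a_ac intro!: bexI R.l_neg M.l_neg)
    show "comm_monoid (R \<ltimes> L)"
      apply (rule comm_monoidI)
          apply (auto simp: idealization_def smult_r_distr smult_l_distr R.m_ac M.a_ac smult_assoc1[symmetric])
      done
  qed (auto simp: idealization_def R.l_distr smult_l_distr smult_r_distr M.a_ac)
qed

lemma free_on_module:
  fixes R (structure)
  assumes "cring R"
  shows "module R (free_on R X)"
proof -
  interpret cring R by fact
  have fin: "finite {x. f x \<noteq> \<zero>} \<Longrightarrow> finite {x. g x \<noteq> \<zero>} \<Longrightarrow> finite {x. f x \<oplus> g x \<noteq> \<zero>}"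
    for f g :: "_ \<Rightarrow> 'a"
    by (rule finite_subset[of _ "{x. f x \<noteq> \<zero>} \<union> {x. g x \<noteq> \<zero>}"]) auto
  have ag: "abelian_group (free_on R X)"
  proof (rule abelian_groupI)
    fix f assume "f \<in> carrier (free_on R X)"
    then show "\<exists>g\<in>carrier (free_on R X). g \<oplus>\<^bsub>free_on R X\<^esub> f = \<zero>\<^bsub>free_on R X\<^esub>"
      by (intro bexI[of _ "\<lambda>x. \<ominus> f x"])
        (auto simp: free_on_def l_neg fun_eq_iff elim!: rev_finite_subset)
  qed (auto simp: free_on_def a_ac fun_eq_iff intro!: fin, metis (mono_tags) l_zero subsetD mem_Collect_eq zero_closed)
  have cl: "r \<odot>\<^bsub>free_on R X\<^esub> f \<in> carrier (free_on R X)"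
    if "r \<in> carrier R" "f \<in> carrier (free_on R X)" for r f
    using that by (auto simp: free_on_def elim!: rev_finite_subset)
  show ?thesis
    by (rule moduleI[OF assms ag cl]) (auto simp: free_on_def fun_eq_iff l_distr r_distr m_assoc)
qed

definition unit_vec_on :: "('a, 'c) ring_scheme \<Rightarrow> 'x \<Rightarrow> 'x \<Rightarrow> 'a" where
  "unit_vec_on R x = (\<lambda>y. if y = x then \<one>\<^bsub>R\<^esub> else \<zero>\<^bsub>R\<^esub>)"

lemma (in module) lin_ext_superset:
  assumes "f \<in> carrier (free_on R X)" "v \<in> X \<rightarrow> carrier M"
    and "finite B" "{b. f b \<noteq> \<zero>} \<subseteq> B" "B \<subseteq> X"
  shows "(\<Oplus>\<^bsub>M\<^esub>b\<in>{b. f b \<noteq> \<zero>}. f b \<odot>\<^bsub>M\<^esub> v b) = (\<Oplus>\<^bsub>M\<^esub>b\<in>B. f b \<odot>\<^bsub>M\<^esub> v b)"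
  by (rule M.add.finprod_mono_neutral_cong_left) (use assms in \<open>auto simp: free_on_def Pi_iff\<close>)

lemma (in module) lin_ext_hom:
  assumes v: "v \<in> X \<rightarrow> carrier M"
  shows "(\<lambda>f. \<Oplus>\<^bsub>M\<^esub>b\<in>{b. f b \<noteq> \<zero>}. f b \<odot>\<^bsub>M\<^esub> v b) \<in> module_hom R (free_on R X) M"
    (is "?L \<in> _")
proof -
  interpret F: module R "free_on R X" by (rule free_on_module) (rule is_cring)
  show ?thesis
    unfolding module_hom_def
  proof (intro CollectI conjI funcsetI allI impI; (elim conjE)?)
    fix f assume "f \<in> carrier (free_on R X)"
    then show "?L f \<in> carrier M"
      using v by (intro M.finsum_closed) (auto simp: free_on_def Pi_iff)
  next
    fix f g assume fg: "f \<in> carrier (free_on R X)" "g \<in> carrier (free_on R X)"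
    let ?B = "{b. f b \<noteq> \<zero>} \<union> {b. g b \<noteq> \<zero>}"
    have B: "finite ?B" "?B \<subseteq> X" using fg by (auto simp: free_on_def)
    have fg': "f \<oplus>\<^bsub>free_on R X\<^esub> g \<in> carrier (free_on R X)" using fg by simp
    have s: "{b. (f \<oplus>\<^bsub>free_on R X\<^esub> g) b \<noteq> \<zero>} \<subseteq> ?B" by (auto simp: free_on_def)
    have c: "f b \<in> carrier R" "g b \<in> carrier R" for b using fg by (auto simp: free_on_def)
    have vb: "b \<in> ?B \<Longrightarrow> v b \<in> carrier M" for b using B v by blast
    show "?L (f \<oplus>\<^bsub>free_on R X\<^esub> g) = ?L f \<oplus>\<^bsub>M\<^esub> ?L g"
      apply (subst (1 2 3) lin_ext_superset[OF _ v B(1) _ B(2)])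
            apply (use fg fg' s in auto)[6]
      apply (subst M.finsum_addf[symmetric])
        apply (use c vb in \<open>auto simp: Pi_iff\<close>)[2]
      apply (rule M.finsum_cong')
        apply (use c vb in \<open>auto simp: free_on_def smult_l_distr\<close>)
      done
  next
    fix r f assume rf: "r \<in> carrier R" "f \<in> carrier (free_on R X)"
    let ?B = "{b. f b \<noteq> \<zero>}"
    have B: "finite ?B" "?B \<subseteq> X" using rf by (auto simp: free_on_def)
    have rf': "r \<odot>\<^bsub>free_on R X\<^esub> f \<in> carrier (free_on R X)" using rf by simp
    have s: "{b. (r \<odot>\<^bsub>free_on R X\<^esub> f) b \<noteq> \<zero>} \<subseteq> ?B" using rf by (auto simp: free_on_def)
    have c: "f b \<in> carrier R" for b using rf by (auto simp: free_on_def)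
    have vb: "b \<in> ?B \<Longrightarrow> v b \<in> carrier M" for b using B v by blast
    have "?L (r \<odot>\<^bsub>free_on R X\<^esub> f) = (\<Oplus>\<^bsub>M\<^esub>b\<in>?B. (r \<odot>\<^bsub>free_on R X\<^esub> f) b \<odot>\<^bsub>M\<^esub> v b)"
      by (rule lin_ext_superset[OF rf' v B(1) s B(2)])
    also have "\<dots> = (\<Oplus>\<^bsub>M\<^esub>b\<in>?B. r \<odot>\<^bsub>M\<^esub> (f b \<odot>\<^bsub>M\<^esub> v b))"
      by (rule M.finsum_cong') (use c vb rf in \<open>auto simp: free_on_def smult_assoc1\<close>)
    also have "\<dots> = r \<odot>\<^bsub>M\<^esub> ?L f"
      by (rule finsum_smult_ldistr[symmetric]) (use B c vb rf in auto)
    finally show "?L (r \<odot>\<^bsub>free_on R X\<^esub> f) = r \<odot>\<^bsub>M\<^esub> ?L f" .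
  qed
qed

lemma (in module) lin_ext_unit_vec:
  assumes "v x \<in> carrier M"
  shows "(\<Oplus>\<^bsub>M\<^esub>b\<in>{b. unit_vec_on R x b \<noteq> \<zero>}. unit_vec_on R x b \<odot>\<^bsub>M\<^esub> v b) = v x"
proof (cases "\<one> = \<zero>")
  case True
  then have "{b. unit_vec_on R x b \<noteq> \<zero>} = {}" by (auto simp: unit_vec_on_def)
  moreover have "v x = \<zero>\<^bsub>M\<^esub>"
    using smult_one[OF assms] smult_l_null[OF assms] True by simp
  ultimately show ?thesis by simp
next
  case False
  then have "{b. unit_vec_on R x b \<noteq> \<zero>} = {x}" by (auto simp: unit_vec_on_def)
  then show ?thesis using assms by (simp add: unit_vec_on_def)
qed

lemma (in cring) unit_vec_on_carrier: "x \<in> X \<Longrightarrow> unit_vec_on R x \<in> carrier (free_on R X)"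
  by (auto simp: unit_vec_on_def free_on_def)

lemma (in cring) free_on_finsum:
  assumes "finite A" "g \<in> A \<rightarrow> carrier (free_on R X)"
  shows "(\<Oplus>\<^bsub>free_on R X\<^esub>b\<in>A. g b) x = (\<Oplus>b\<in>A. g b x)"
proof -
  interpret F: module R "free_on R X" by (rule free_on_module) (rule is_cring)
  show ?thesis
    using assms
  proof induction
    case empty
    have "\<zero>\<^bsub>free_on R X\<^esub> x = \<zero>" by (simp add: free_on_def)
    then show ?case by simp
  next
    case (insert a A)
    then have "(\<lambda>b. g b x) \<in> A \<rightarrow> carrier R" "g a x \<in> carrier R" by (auto simp: free_on_def)
    with insert show ?case by (simp add: Pi_iff) (simp add: free_on_def)
  qed
qed

lemma free_on_free:
  fixes R (structure) and X :: "'x set"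
  assumes "cring R"
  shows "free_module R (free_on R X)"
proof -
  interpret cring R by fact
  interpret F: module R "free_on R X" by (rule free_on_module) fact
  have u: "unit_vec_on R \<in> X \<rightarrow> carrier (free_on R X)" using unit_vec_on_carrier by auto
  let ?B = "unit_vec_on R ` X - (if \<one> = \<zero> then UNIV else {})"
  have sub: "?B \<subseteq> carrier (free_on R X)" using u by auto
  have inj: "inj (unit_vec_on R :: 'x \<Rightarrow> _)" if "\<one> \<noteq> \<zero>"
    using that by (auto simp: inj_def unit_vec_on_def fun_eq_iff split: if_splits)
  have "\<not> F.lin_dep ?B"
  proof
    assume "F.lin_dep ?B"
    then obtain A a w where A: "finite A" "A \<subseteq> ?B" "a \<in> A \<rightarrow> carrier R"
        "F.lincomb a A = \<zero>\<^bsub>free_on R X\<^esub>" "w \<in> A" "a w \<noteq> \<zero>"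
      unfolding F.lin_dep_def by blast
    then have ne: "\<one> \<noteq> \<zero>" by (auto split: if_splits)
    from A obtain x where x: "x \<in> X" "w = unit_vec_on R x" by auto
    have "\<zero> = F.lincomb a A x" using A by (simp add: free_on_def)
    also have "\<dots> = (\<Oplus>v\<in>A. (a v \<odot>\<^bsub>free_on R X\<^esub> v) x)"
      unfolding F.lincomb_def
      by (rule free_on_finsum) (use A sub in \<open>auto intro!: F.smult_closed simp del: F.smult_closed\<close>)
    also have "\<dots> = (\<Oplus>v\<in>A. if w = v then a v else \<zero>)"
    proof (rule finsum_cong')
      fix v assume v: "v \<in> A"
      with A obtain y where y: "v = unit_vec_on R y" by auto
      show "(a v \<odot>\<^bsub>free_on R X\<^esub> v) x = (if w = v then a v else \<zero>)"
      proof (cases "x = y")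
        case True
        moreover have "a v \<in> carrier R" using A(3) v by blast
        ultimately show ?thesis by (simp add: free_on_def) (simp add: x y unit_vec_on_def)
      next
        case False
        then have "w \<noteq> v" using inj[OF ne] by (simp add: x y inj_eq)
        moreover have "a v \<in> carrier R" using A(3) v by blast
        ultimately show ?thesis using False by (simp add: free_on_def) (simp add: y unit_vec_on_def)
      qed
    qed (use A in auto)
    also have "\<dots> = a w" by (rule add.finprod_singleton) (use A in auto)
    finally show False using A by simp
  qed
  moreover have "f \<in> F.span ?B" if f: "f \<in> carrier (free_on R X)" for f
  proof (cases "\<one> = \<zero>")
    case True
    have "carrier R = {\<zero>}" by (rule one_zeroD) (rule True)
    then have "f x = \<zero>" for x using f unfolding free_on_def by simp
    then have "f = \<zero>\<^bsub>free_on R X\<^esub>" by (simp add: free_on_def fun_eq_iff)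
    moreover have "\<zero>\<^bsub>free_on R X\<^esub> \<in> F.span ?B"
      by (rule submodule.zero_closed[OF F.span_is_submodule[OF sub]])
    ultimately show ?thesis by (simp only:)
  next
    case False
    let ?S = "{x. f x \<noteq> \<zero>}"
    have S: "finite ?S" "?S \<subseteq> X" and c: "f x \<in> carrier R" for x using f by (auto simp: free_on_def)
    have injS: "inj_on (unit_vec_on R) ?S" using inj[OF False] by (rule inj_on_subset) simp
    let ?a = "\<lambda>w. f (inv_into ?S (unit_vec_on R) w)"
    have "F.lincomb ?a (unit_vec_on R ` ?S) = (\<Oplus>\<^bsub>free_on R X\<^esub>x\<in>?S. f x \<odot>\<^bsub>free_on R X\<^esub> unit_vec_on R x)"
      unfolding F.lincomb_def
      apply (subst F.M.add.finprod_reindex[OF _ injS])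
      subgoal by (rule funcsetI, rule F.smult_closed) (use c S u in blast)+
      subgoal by (rule F.M.finsum_cong', rule refl, rule funcsetI, rule F.smult_closed)
          (use c S u injS in \<open>blast | simp add: inv_into_f_f\<close>)+
      done
    also have "\<dots> = f"
    proof
      fix y
      have "(\<Oplus>\<^bsub>free_on R X\<^esub>x\<in>?S. f x \<odot>\<^bsub>free_on R X\<^esub> unit_vec_on R x) y
          = (\<Oplus>x\<in>?S. (f x \<odot>\<^bsub>free_on R X\<^esub> unit_vec_on R x) y)"
        by (rule free_on_finsum, rule S, rule funcsetI, rule F.smult_closed) (use S c u in blast)+
      also have "\<dots> = (\<Oplus>x\<in>?S. if y = x then f x else \<zero>)"
        by (rule finsum_cong', rule refl) (use c in \<open>simp_all add: free_on_def unit_vec_on_def\<close>)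
      also have "\<dots> = f y"
      proof (cases "y \<in> ?S")
        case True
        then show ?thesis by (intro add.finprod_singleton) (use S c in auto)
      next
        case False
        then have "(\<Oplus>x\<in>?S. if y = x then f x else \<zero>) = (\<Oplus>x\<in>?S. \<zero>)"
          by (intro finsum_cong') auto
        with False show ?thesis by simp
      qed
      finally show "(\<Oplus>\<^bsub>free_on R X\<^esub>x\<in>?S. f x \<odot>\<^bsub>free_on R X\<^esub> unit_vec_on R x) y = f y" .
    qed
    finally have "f = F.lincomb ?a (unit_vec_on R ` ?S)" ..
    moreover have "unit_vec_on R ` ?S \<subseteq> ?B" using S False by auto
    ultimately show ?thesis
      unfolding F.span_def using S(1) c by (intro CollectI exI[of _ ?a] exI[of _ "unit_vec_on R ` ?S"] conjI) (assumption | simp)+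
  qed
  moreover have "F.span ?B \<subseteq> carrier (free_on R X)"
    using F.span_is_subset2[OF sub] .
  ultimately show ?thesis
    unfolding free_module_def using sub F.module_axioms by (intro conjI exI[of _ ?B]) (assumption | blast)+
qed

lemma (in mod_hom) finsum_in_ker:
  assumes "finite A" "\<And>b. b \<in> A \<Longrightarrow> g b \<in> carrier M" "\<And>b. b \<in> A \<Longrightarrow> f (g b) = \<zero>\<^bsub>N\<^esub>"
  shows "f (\<Oplus>\<^bsub>M\<^esub>b\<in>A. g b) = \<zero>\<^bsub>N\<^esub>"
  using assms by induction (simp_all add: Pi_iff)

text \<open>The standard resolution consists of free modules and is exact, and the \<open>Ext\<close> computed from it
  is an abelian group.\<close>

lemma syz_elem_name:
  assumes "f \<in> carrier (free_on R X)"
  shows "syz_elem R (syz_name R f) = f"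
proof -
  have "{(x, f x) |x. f x \<noteq> \<zero>\<^bsub>R\<^esub>} = (\<lambda>x. (x, f x)) ` {x. f x \<noteq> \<zero>\<^bsub>R\<^esub>}" by auto
  then have "finite {(x, f x) |x. f x \<noteq> \<zero>\<^bsub>R\<^esub>}" using assms by (simp add: free_on_def)
  then show ?thesis by (auto simp: syz_elem_def syz_name_def fun_eq_iff Abs_fset_inverse)
qed

lemma (in module) res_exact:
  shows "free_module R (res_mod R M n)"
    and "res_aug R M \<in> module_hom R (res_mod R M 0) M"
    and "res_aug R M ` carrier (res_mod R M 0) = carrier M"
    and "res_diff R \<in> module_hom R (res_mod R M (Suc n)) (res_mod R M n)"
    and "res_diff R ` carrier (res_mod R M 1) = {f \<in> carrier (res_mod R M 0). res_aug R M f = \<zero>\<^bsub>M\<^esub>}"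
    and "res_diff R ` carrier (res_mod R M (Suc (Suc n))) =
      {f \<in> carrier (res_mod R M (Suc n)). res_diff R f = \<zero>\<^bsub>res_mod R M n\<^esub>}"
proof -
  have cr: "cring R" by (rule is_cring)
  show "free_module R (res_mod R M n)" unfolding res_mod_def by (rule free_on_free[OF cr])
  have g: "gen_elem \<in> res_basis_set R M 0 \<rightarrow> carrier M" by auto
  show h: "res_aug R M \<in> module_hom R (res_mod R M 0) M"
    using lin_ext_hom[OF g] unfolding res_mod_def res_aug_def .
  have hc: "f \<in> carrier (res_mod R M 0) \<Longrightarrow> res_aug R M f \<in> carrier M" for f
    using h by (auto simp: module_hom_def)
  have "m \<in> res_aug R M ` carrier (res_mod R M 0)" if "m \<in> carrier M" for m
  proof
    show "m = res_aug R M (unit_vec_on R (Gen m))"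
      unfolding res_aug_def by (subst lin_ext_unit_vec) (use that in auto)
    show "unit_vec_on R (Gen m) \<in> carrier (res_mod R M 0)"
      unfolding res_mod_def by (rule unit_vec_on_carrier) (use that in auto)
  qed
  with hc show "res_aug R M ` carrier (res_mod R M 0) = carrier M" by auto
  let ?Z = "\<lambda>n. {f \<in> carrier (res_mod R M n).
      (case n of 0 \<Rightarrow> res_aug R M f = \<zero>\<^bsub>M\<^esub> | Suc _ \<Rightarrow> res_diff R f = (\<lambda>x. \<zero>\<^bsub>R\<^esub>))}"
  have e: "syz_elem R \<in> res_basis_set R M (Suc n) \<rightarrow> ?Z n" for n
  proof
    fix b assume "b \<in> res_basis_set R M (Suc n)"
    then obtain f where f: "f \<in> ?Z n" "b = syz_name R f" by (auto simp: res_mod_def)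
    then have "f \<in> carrier (free_on R (res_basis_set R M n))" by (simp add: res_mod_def)
    with f show "syz_elem R b \<in> ?Z n" by (simp only: syz_elem_name)
  qed
  have eq: "res_diff R f = (\<Oplus>\<^bsub>res_mod R M n\<^esub>b\<in>{b. f b \<noteq> \<zero>}. f b \<odot>\<^bsub>res_mod R M n\<^esub> syz_elem R b)"
    if f: "f \<in> carrier (res_mod R M (Suc n))" for f n
  proof
    fix x
    interpret F: module R "res_mod R M n" unfolding res_mod_def by (rule free_on_module[OF cr])
    have sub: "{b. f b \<noteq> \<zero>} \<subseteq> res_basis_set R M (Suc n)" "finite {b. f b \<noteq> \<zero>}" "\<And>b. f b \<in> carrier R"
      using f unfolding res_mod_def by (auto simp: free_on_def)
    have "(\<lambda>b. f b \<odot>\<^bsub>res_mod R M n\<^esub> syz_elem R b) \<in> {b. f b \<noteq> \<zero>} \<rightarrow> carrier (res_mod R M n)"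
      using e[of n] sub by (intro funcsetI F.smult_closed) auto
    from free_on_finsum[OF sub(2) this[unfolded res_mod_def]]
    show "res_diff R f x =
      (\<Oplus>\<^bsub>res_mod R M n\<^esub>b\<in>{b. f b \<noteq> \<zero>}. f b \<odot>\<^bsub>res_mod R M n\<^esub> syz_elem R b) x"
      by (simp add: res_mod_def res_diff_def) (simp add: free_on_def)
  qed
  have d: "res_diff R \<in> module_hom R (res_mod R M (Suc n)) (res_mod R M n)" for n
  proof -
    interpret F: module R "res_mod R M n" unfolding res_mod_def by (rule free_on_module[OF cr])
    interpret F': module R "res_mod R M (Suc n)" unfolding res_mod_def by (rule free_on_module[OF cr])
    have "syz_elem R \<in> res_basis_set R M (Suc n) \<rightarrow> carrier (res_mod R M n)" using e[of n] by auto
    from F.lin_ext_hom[OF this] have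
      "(\<lambda>f. \<Oplus>\<^bsub>res_mod R M n\<^esub>b\<in>{b. f b \<noteq> \<zero>}. f b \<odot>\<^bsub>res_mod R M n\<^esub> syz_elem R b) \<in> module_hom R (res_mod R M (Suc n)) (res_mod R M n)"
      by (simp add: res_mod_def)
    then show ?thesis by (auto simp: module_hom_def eq[of _ n] Pi_iff)
  qed
  then show "res_diff R \<in> module_hom R (res_mod R M (Suc n)) (res_mod R M n)" .
  have z: "\<zero>\<^bsub>res_mod R M n\<^esub> = (\<lambda>x. \<zero>)" for n by (simp add: res_mod_def free_on_def)
  have span: "h (res_diff R f) = \<zero>\<^bsub>N\<^esub>"
    if f: "f \<in> carrier (res_mod R M (Suc n))" and N: "module R N"
      and h: "h \<in> module_hom R (res_mod R M n) N" and hz: "\<And>g. g \<in> ?Z n \<Longrightarrow> h g = \<zero>\<^bsub>N\<^esub>"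
    for f n h and N :: "('a, 'z) module"
  proof -
    interpret F: module R "res_mod R M n" unfolding res_mod_def by (rule free_on_module[OF cr])
    interpret N: module R N by fact
    interpret H: mod_hom R "res_mod R M n" N h by unfold_locales (rule h)
    have sub: "{b. f b \<noteq> \<zero>} \<subseteq> res_basis_set R M (Suc n)" "finite {b. f b \<noteq> \<zero>}" "\<And>b. f b \<in> carrier R"
      using f unfolding res_mod_def by (auto simp: free_on_def)
    have sz: "b \<in> {b. f b \<noteq> \<zero>} \<Longrightarrow> syz_elem R b \<in> ?Z n" for b using e[of n] sub by blast
    have "h (\<Oplus>\<^bsub>res_mod R M n\<^esub>b\<in>{b. f b \<noteq> \<zero>}. f b \<odot>\<^bsub>res_mod R M n\<^esub> syz_elem R b) = \<zero>\<^bsub>N\<^esub>"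
    proof (rule H.finsum_in_ker[OF sub(2)])
      fix b assume "b \<in> {b. f b \<noteq> \<zero>}"
      from sz[OF this] have *: "syz_elem R b \<in> carrier (res_mod R M n)" "h (syz_elem R b) = \<zero>\<^bsub>N\<^esub>" using hz by blast+
      then show "f b \<odot>\<^bsub>res_mod R M n\<^esub> syz_elem R b \<in> carrier (res_mod R M n)" using sub by (intro F.smult_closed)
      show "h (f b \<odot>\<^bsub>res_mod R M n\<^esub> syz_elem R b) = \<zero>\<^bsub>N\<^esub>" using H.f_smult[of "f b" "syz_elem R b"] * sub by simp
    qed
    then show ?thesis using eq[OF f] by simp
  qed
  have im: "f \<in> res_diff R ` carrier (res_mod R M (Suc n))" if f: "f \<in> ?Z n" for f n
  proof
    interpret F: module R "res_mod R M n" unfolding res_mod_def by (rule free_on_module[OF cr])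
    let ?u = "unit_vec_on R (syz_name R f)"
    show u: "?u \<in> carrier (res_mod R M (Suc n))"
      unfolding res_mod_def by (rule unit_vec_on_carrier) (use f in \<open>auto simp: res_mod_def\<close>)
    have "syz_elem R (syz_name R f) = f" using f syz_elem_name unfolding res_mod_def by blast
    then show "f = res_diff R ?u"
      unfolding eq[OF u] by (subst F.lin_ext_unit_vec) (use f in auto)
  qed
  have dc: "f \<in> carrier (res_mod R M (Suc n)) \<Longrightarrow> res_diff R f \<in> carrier (res_mod R M n)" for f n
    using d[of n] by (auto simp: module_hom_def)
  interpret MM: module R M by (rule module_axioms)
  show "res_diff R ` carrier (res_mod R M 1) = {f \<in> carrier (res_mod R M 0). res_aug R M f = \<zero>\<^bsub>M\<^esub>}"
  proof -
    have "res_aug R M (res_diff R f) = \<zero>\<^bsub>M\<^esub>" if f: "f \<in> carrier (res_mod R M 1)" for f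
    proof -
      interpret F: module R "res_mod R M 0" unfolding res_mod_def by (rule free_on_module[OF cr])
      interpret H: mod_hom R "res_mod R M 0" M "res_aug R M" by unfold_locales (rule h)
      have sub: "{b. f b \<noteq> \<zero>} \<subseteq> res_basis_set R M (Suc 0)" "finite {b. f b \<noteq> \<zero>}" "\<And>b. f b \<in> carrier R"
        using f unfolding res_mod_def by (auto simp: free_on_def)
      have sz: "b \<in> {b. f b \<noteq> \<zero>} \<Longrightarrow> syz_elem R b \<in> ?Z 0" for b using e[of 0] sub by blast
      have "res_aug R M (\<Oplus>\<^bsub>res_mod R M 0\<^esub>b\<in>{b. f b \<noteq> \<zero>}. f b \<odot>\<^bsub>res_mod R M 0\<^esub> syz_elem R b) = \<zero>\<^bsub>M\<^esub>"
      proof (rule H.finsum_in_ker[OF sub(2)])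
        fix b assume "b \<in> {b. f b \<noteq> \<zero>}"
        from sz[OF this] have *: "syz_elem R b \<in> carrier (res_mod R M 0)" "res_aug R M (syz_elem R b) = \<zero>\<^bsub>M\<^esub>" by auto
        then show "f b \<odot>\<^bsub>res_mod R M 0\<^esub> syz_elem R b \<in> carrier (res_mod R M 0)" using sub by (intro F.smult_closed)
        show "res_aug R M (f b \<odot>\<^bsub>res_mod R M 0\<^esub> syz_elem R b) = \<zero>\<^bsub>M\<^esub>" using H.f_smult[of "f b" "syz_elem R b"] * sub by simp
      qed
      then show ?thesis using eq[of f 0] f by simp
    qed
    then show ?thesis using dc[of _ 0] im[of _ 0] by auto
  qed
  show "res_diff R ` carrier (res_mod R M (Suc (Suc n))) =
      {f \<in> carrier (res_mod R M (Suc n)). res_diff R f = \<zero>\<^bsub>res_mod R M n\<^esub>}"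
  proof -
    have "res_diff R (res_diff R f) = \<zero>\<^bsub>res_mod R M n\<^esub>" if f: "f \<in> carrier (res_mod R M (Suc (Suc n)))" for f
      proof (rule span[OF f _ d])
      show "module R (res_mod R M n)" unfolding res_mod_def by (rule free_on_module[OF cr])
    qed (simp add: z)
    then show ?thesis using dc[of _ "Suc n"] im[of _ "Suc n"] by (auto simp: z)
  qed
qed

lemma hom_group_comm_group:
  assumes "module R P" "module R N"
  shows "comm_group (hom_group R P N)"
proof -
  interpret P: module R P by fact
  interpret N: module R N by fact
  show ?thesis
  proof (rule comm_groupI)
    fix f assume f: "f \<in> carrier (hom_group R P N)"
    then show "\<exists>g\<in>carrier (hom_group R P N). g \<otimes>\<^bsub>hom_group R P N\<^esub> f = \<one>\<^bsub>hom_group R P N\<^esub>"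
      by (intro bexI[of _ "\<lambda>x\<in>carrier P. \<ominus>\<^bsub>N\<^esub> f x"])
        (auto simp: hom_group_def module_hom_def Pi_iff N.M.l_neg N.M.minus_add N.smult_r_minus
          N.M.a_comm intro!: restrict_ext, simp add: N.M.a_comm N.M.r_neg)
  qed (auto simp: hom_group_def module_hom_def Pi_iff N.M.a_ac N.smult_r_distr extensional_def
      restrict_def fun_eq_iff intro!: restrict_ext)
qed

lemma (in module) Ext_comm_group:
  assumes "module R N"
  shows "comm_group (Ext R i M N)"
proof -
  interpret N: module R N by fact
  have cr: "cring R" by (rule is_cring)
  let ?P = "res_mod R M" and ?d = "res_diff R"
  have Pm: "module R (?P n)" for n unfolding res_mod_def by (rule free_on_module[OF cr])
  have dh: "?d \<in> module_hom R (?P (Suc n)) (?P n)" for n by (rule res_exact)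
  have dc: "x \<in> carrier (?P (Suc n)) \<Longrightarrow> ?d x \<in> carrier (?P n)" for x n
    using dh[of n] by (auto simp: module_hom_def)
  have da: "?d (x \<oplus>\<^bsub>?P (Suc n)\<^esub> y) = ?d x \<oplus>\<^bsub>?P n\<^esub> ?d y"
    if "x \<in> carrier (?P (Suc n))" "y \<in> carrier (?P (Suc n))" for x y n
    using dh[of n] that by (auto simp: module_hom_def)
  have ds: "?d (r \<odot>\<^bsub>?P (Suc n)\<^esub> x) = r \<odot>\<^bsub>?P n\<^esub> ?d x"
    if "x \<in> carrier (?P (Suc n))" "r \<in> carrier R" for x r n
    using dh[of n] that by (auto simp: module_hom_def)
  let ?H = "\<lambda>n. hom_group R (?P n) N"
  have G: "comm_group (?H n)" for n by (rule hom_group_comm_group[OF Pm assms])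
  let ?D = "\<lambda>n g. \<lambda>x\<in>carrier (?P (Suc n)). g (?d x)"
  have D: "?D n \<in> hom (?H n) (?H (Suc n))" for n
  proof (rule homI)
    fix f assume f: "f \<in> carrier (?H n)"
    interpret P: module R "?P (Suc n)" by (rule Pm)
    show "?D n f \<in> carrier (?H (Suc n))"
      using f dc[of _ n] by (auto simp: hom_group_def module_hom_def Pi_iff da ds)
  next
    fix f g assume "f \<in> carrier (?H n)" "g \<in> carrier (?H n)"
    then show "?D n (f \<otimes>\<^bsub>?H n\<^esub> g) = ?D n f \<otimes>\<^bsub>?H (Suc n)\<^esub> ?D n g"
      using dc[of _ n] by (auto simp: hom_group_def intro!: restrict_ext)
  qed
  have gh: "group_hom (?H n) (?H (Suc n)) (?D n)" for n
    using G[of n] G[of "Suc n"] D by (simp add: group_hom_def group_hom_axioms_def comm_group_def)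
  have Z: "cocycles R ?P (\<lambda>_. ?d) N n = kernel (?H n) (?H (Suc n)) (?D n)" for n
    by (auto simp: cocycles_def kernel_def hom_group_def fun_eq_iff restrict_def split: if_splits)
  have sZ: "subgroup (cocycles R ?P (\<lambda>_. ?d) N n) (?H n)" for n
    unfolding Z using gh by (rule group_hom.subgroup_kernel)
  have sB: "subgroup (coboundaries R ?P (\<lambda>_. ?d) N n) (?H n)" for n
  proof (cases n)
    case 0
    then show ?thesis using group.triv_subgroup[OF comm_group.axioms(2)[OF G[of 0]]] by (simp add: coboundaries_def)
  next
    case (Suc m)
    then show ?thesis using group_hom.img_is_subgroup[OF gh[of m]] by (simp add: coboundaries_def)
  qed
  have BZ: "coboundaries R ?P (\<lambda>_. ?d) N n \<subseteq> cocycles R ?P (\<lambda>_. ?d) N n" for n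
  proof (cases n)
    case 0
    then show ?thesis using subgroup.one_closed[OF sZ[of 0]] by (simp add: coboundaries_def)
  next
    case (Suc m)
    have "?D m g \<in> cocycles R ?P (\<lambda>_. ?d) N (Suc m)" if g: "g \<in> carrier (?H m)" for g
    proof -
      have "g (?d (?d x)) = \<zero>\<^bsub>N\<^esub>" if x: "x \<in> carrier (?P (Suc (Suc m)))" for x
      proof -
        interpret H: mod_hom R "?P m" N g
          by (intro mod_hom.intro mod_hom_axioms.intro Pm assms) (use g in \<open>simp add: hom_group_def\<close>)
        have "?d x \<in> ?d ` carrier (?P (Suc (Suc m)))" using x by blast
        then have "?d (?d x) = \<zero>\<^bsub>?P m\<^esub>" unfolding res_exact(6) by blast
        then show ?thesis by simp
      qed
      then show ?thesis
        using g dc[of _ "Suc m"] hom_in_carrier[OF D g] by (simp add: cocycles_def)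
    qed
    then show ?thesis using Suc by (auto simp: coboundaries_def)
  qed
  interpret GZ: comm_group "(?H i)\<lparr>carrier := cocycles R ?P (\<lambda>_. ?d) N i\<rparr>"
    using subgroup.subgroup_is_group[OF sZ comm_group.axioms(2)[OF G]] G[of i] subgroup.mem_carrier[OF sZ[of i]]
    by (intro group.group_comm_groupI) (auto simp: comm_group_def comm_monoid.m_comm)
  have "subgroup (coboundaries R ?P (\<lambda>_. ?d) N i) ((?H i)\<lparr>carrier := cocycles R ?P (\<lambda>_. ?d) N i\<rparr>)"
    using group.subgroup_incl[OF comm_group.axioms(2)[OF G[of i]] sB sZ BZ] .
  then show ?thesis
    unfolding Ext_def hom_cohomology_def by (rule GZ.abelian_FactGroup)
qed

end

theory Submission
  imports Defs
begin

text \<open>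
  Write \<open>S = R \<ltimes> k\<close> and \<open>x = (0, 1)\<close>. The maximal ideal \<open>\<nn>\<close> of \<open>S\<close> is the annihilator of \<open>x\<close>, and it splits as
  \<open>\<mm> \<oplus> xS\<close> with \<open>xS \<cong> k\<close>; let \<open>\<pi> : \<nn> \<rightarrow> xS\<close> be the projection. If \<open>M\<close> is not free, then its first syzygy
  for a minimal set of generators is a nonzero submodule of \<open>\<nn>F\<close>, so \<open>x\<close> annihilates it, and some functional to
  \<open>k\<close> is nonzero on it. Covering a syzygy \<open>\<Omega>\<close> with such a functional by a free module \<open>P\<close>, lift an
  element \<open>e\<close> of \<open>\<Omega>\<close> with nonzero value to \<open>p \<in> P\<close>: then \<open>xp\<close> lies in the next syzygy, is annihilated
  by \<open>\<nn>\<close>, and \<open>\<pi>\<close> provides a functional with nonzero value on it. So \<open>k\<close> is a direct summand of every syzygy from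
  the second on, and \<open>Ext\<^sup>i(M, N) = 0\<close> for some \<open>i \<ge> 3\<close> gives \<open>Ext\<^sup>1(k, N) = 0\<close>. Concretely, every \<open>y \<in> N\<close>
  killed by \<open>\<nn>\<close> has the form \<open>xz\<close> with \<open>\<mm>z = 0\<close>. For \<open>N = M \<oplus> S\<close> and \<open>y = (0, x)\<close> this makes the
  second component of \<open>z\<close> a unit, so \<open>\<mm> = 0\<close> and \<open>\<nn> = xS\<close>; for \<open>y = (u, 0)\<close> it shows that the kernel of \<open>x\<close> on
  \<open>M\<close> is \<open>xM\<close>. Then a minimal set of generators of \<open>M\<close> has no relations.
\<close>

section \<open>Local rings whose maximal ideal splits off a copy of the residue field\<close>

text \<open>By the ascending chain condition the union of a nonempty chain of ideals is a member of
  that chain, so Zorn's lemma applies to every nonempty family of ideals.\<close>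

lemma (in noetherian_ring) ex_maximal_in:
  assumes "A \<subseteq> {I. ideal I R}" "A \<noteq> {}"
  shows "\<exists>J\<in>A. \<forall>K\<in>A. J \<subseteq> K \<longrightarrow> K = J"
proof (rule subset_Zorn_nonempty[OF assms(2)])
  fix C assume C: "C \<noteq> {}" "subset.chain A C"
  have "subset.chain {I. ideal I R} C"
    using assms(1) C(2) unfolding subset.chain_def by (meson order_trans)
  from ideal_chain_is_trivial[OF C(1) this] show "\<Union>C \<in> A"
    using C(2) unfolding subset.chain_def by (metis subsetD)
qed

text \<open>A nonunit generates a proper ideal. An ideal maximal among those that contain it and
  avoid \<open>\<one>\<close> is a maximal ideal, hence equal to \<open>\<mm>\<close>.\<close>

lemma (in noetherian_local_ring) Units_if_not_mem:
  assumes r: "r \<in> carrier R" "r \<notin> \<mm>"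
  shows "r \<in> Units R"
proof (rule ccontr)
  assume nu: "r \<notin> Units R"
  let ?I = "PIdl r"
  have I: "ideal ?I R" "r \<in> ?I" using r cgenideal_ideal cgenideal_self by auto
  have one: "\<one> \<notin> ?I"
  proof
    assume "\<one> \<in> ?I"
    then obtain s where s: "s \<in> carrier R" "\<one> = s \<otimes> r" unfolding cgenideal_def by blast
    moreover from s have "r \<otimes> s = \<one>" using r by (simp add: m_comm)
    ultimately have "r \<in> Units R" using r unfolding Units_def by fastforce
    with nu show False ..
  qed
  let ?A = "{J. ideal J R \<and> ?I \<subseteq> J \<and> \<one> \<notin> J}"
  have "\<exists>J\<in>?A. \<forall>K\<in>?A. J \<subseteq> K \<longrightarrow> K = J"
    by (rule ex_maximal_in) (use I one in blast)+
  then obtain J where J: "ideal J R" "?I \<subseteq> J" "\<one> \<notin> J"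
      and m: "\<forall>K\<in>?A. J \<subseteq> K \<longrightarrow> K = J" by blast
  have "maximalideal J R"
  proof (rule maximalidealI[OF J(1)])
    show "carrier R \<noteq> J" using J(3) by auto
    fix K assume K: "ideal K R" "J \<subseteq> K" "K \<subseteq> carrier R"
    show "K = J \<or> K = carrier R"
      using m K J(2) ideal.one_imp_carrier[OF K(1)] by blast
  qed
  then show False using maximalideal_unique I J r by blast
qed

text \<open>The maximal ideal is the annihilator of \<open>x\<close>, and \<open>\<pi>\<close> is a projection of it onto the ideal generated by
  \<open>x\<close>; values of \<open>\<pi>\<close> off the annihilator are irrelevant.\<close>

locale split_socle = noetherian_ring R + cring R for R (structure) +
  fixes x \<pi>
  assumes x_closed [simp]: "x \<in> carrier R"
    and x_square: "x \<otimes> x = \<zero>"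
    and x_nonzero: "x \<noteq> \<zero>"
    and unit: "\<lbrakk>s \<in> carrier R; s \<otimes> x \<noteq> \<zero>\<rbrakk> \<Longrightarrow> s \<in> Units R"
    and proj_multiple: "\<lbrakk>s \<in> carrier R; s \<otimes> x = \<zero>\<rbrakk> \<Longrightarrow> \<exists>t\<in>carrier R. \<pi> s = t \<otimes> x"
    and proj_add: "\<lbrakk>s \<in> carrier R; s \<otimes> x = \<zero>; t \<in> carrier R; t \<otimes> x = \<zero>\<rbrakk> \<Longrightarrow> \<pi> (s \<oplus> t) = \<pi> s \<oplus> \<pi> t"
    and proj_mult: "\<lbrakk>s \<in> carrier R; s \<otimes> x = \<zero>; t \<in> carrier R\<rbrakk> \<Longrightarrow> \<pi> (t \<otimes> s) = t \<otimes> \<pi> s"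
    and proj_x: "\<pi> x = x"
begin

lemma proj_closed: "s \<in> carrier R \<Longrightarrow> s \<otimes> x = \<zero> \<Longrightarrow> \<pi> s \<in> carrier R"
  using proj_multiple by fastforce

text \<open>The quotient of \<open>I\<close> by a maximal proper subideal is isomorphic to the residue field, that is, to the ideal
  generated by \<open>x\<close>.\<close>

lemma ideal_functional:
  assumes I: "ideal I R" "I \<noteq> {\<zero>}"
  obtains \<theta> where "\<And>s. s \<in> I \<Longrightarrow> \<exists>t\<in>carrier R. \<theta> s = t \<otimes> x"
    "\<And>s t. s \<in> I \<Longrightarrow> t \<in> I \<Longrightarrow> \<theta> (s \<oplus> t) = \<theta> s \<oplus> \<theta> t"
    "\<And>s t. s \<in> I \<Longrightarrow> t \<in> carrier R \<Longrightarrow> \<theta> (t \<otimes> s) = t \<otimes> \<theta> s"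
    "x \<in> \<theta> ` I"
proof -
  interpret I: ideal I R by fact
  let ?A = "{J. ideal J R \<and> J \<subset> I}"
  have "{\<zero>} \<subset> I" using I(2) I.zero_closed by blast
  then have "\<exists>J\<in>?A. \<forall>K\<in>?A. J \<subseteq> K \<longrightarrow> K = J"
    using zeroideal by (intro ex_maximal_in) blast+
  then obtain J where J: "ideal J R" "J \<subset> I"
    and max: "\<forall>K\<in>?A. J \<subseteq> K \<longrightarrow> K = J" by blast
  interpret J: ideal J R by fact
  obtain a where a: "a \<in> I" "a \<notin> J" using J by blast
  have ac: "a \<in> carrier R" using a I.a_Hcarr by blast
  \<comment> \<open>The ideal \<open>J + (a)\<close> lies in \<open>I\<close> and is strictly larger
    than \<open>J\<close>, so by maximality it is \<open>I\<close>.\<close>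
  have decomp: "\<exists>j\<in>J. \<exists>t\<in>carrier R. s = j \<oplus> t \<otimes> a" if "s \<in> I" for s
  proof -
    interpret P: ideal "PIdl a" R using ac by (rule cgenideal_ideal)
    let ?K = "J <+>\<^bsub>R\<^esub> PIdl a"
    have K: "ideal ?K R" by (rule add_ideals) unfold_locales
    have mem: "u \<in> ?K \<longleftrightarrow> (\<exists>j\<in>J. \<exists>t\<in>carrier R. u = j \<oplus> t \<otimes> a)" for u
      unfolding set_add_defs cgenideal_def by auto
    have "j \<in> ?K" if "j \<in> J" for j
      unfolding mem using that ac by (intro bexI[of _ j] bexI[of _ \<zero>]) auto
    moreover have "a \<in> ?K"
      unfolding mem using ac by (intro bexI[of _ \<zero>] bexI[of _ \<one>]) auto
    moreover have "?K \<subseteq> I"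
    proof
      fix u assume "u \<in> ?K"
      then obtain j t where "j \<in> J" "t \<in> carrier R" "u = j \<oplus> t \<otimes> a" unfolding mem by blast
      with J a I.I_l_closed I.a_closed show "u \<in> I" by auto
    qed
    ultimately have "?K = I" using max K a by (metis (mono_tags, lifting) mem_Collect_eq psubsetI subsetI)
    then show ?thesis using mem that by blast
  qed
  \<comment> \<open>A unit \<open>t\<close> would bring \<open>a\<close> itself into
    \<open>J\<close>, and by \<open>unit\<close> a nonunit kills \<open>x\<close>. So the
    coefficient of \<open>a\<close> modulo \<open>J\<close> matters only up to the annihilator of
    \<open>x\<close>.\<close>
  have ann: "t \<otimes> x = \<zero>" if "t \<in> carrier R" "t \<otimes> a \<in> J" for t
  proof (rule ccontr)
    assume "t \<otimes> x \<noteq> \<zero>"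
    then have t: "t \<in> Units R" using unit that by blast
    then have "inv t \<otimes> (t \<otimes> a) \<in> J" using that J.I_l_closed by blast
    moreover have "inv t \<otimes> (t \<otimes> a) = a" using t ac that by (simp add: m_assoc[symmetric])
    ultimately show False using a by simp
  qed
  have uniq: "t \<otimes> x = t' \<otimes> x"
    if "j \<oplus> t \<otimes> a = j' \<oplus> t' \<otimes> a" "j \<in> J" "j' \<in> J" "t \<in> carrier R" "t' \<in> carrier R" for j j' t t'
  proof -
    have c: "j \<in> carrier R" "j' \<in> carrier R" using that J.a_Hcarr by auto
    have "(t \<ominus> t') \<otimes> a = (j \<oplus> t \<otimes> a) \<ominus> j \<ominus> t' \<otimes> a" using c that(4,5) ac by algebra
    also have "\<dots> = j' \<ominus> j" unfolding that(1) using c that(4,5) ac by algebra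
    finally have "(t \<ominus> t') \<otimes> a \<in> J" using that by (simp add: a_minus_def)
    then have "(t \<ominus> t') \<otimes> x = \<zero>" using ann that by simp
    moreover have "(t \<ominus> t') \<otimes> x = t \<otimes> x \<ominus> t' \<otimes> x" using that(4,5) x_closed by algebra
    ultimately show ?thesis using that by simp
  qed
  \<comment> \<open>The map sends \<open>j \<oplus> t \<otimes> a\<close> to
    \<open>t \<otimes> x\<close>; by \<open>uniq\<close> the chosen value does not depend on the
    decomposition.\<close>
  define \<theta> where "\<theta> s = (SOME y. \<exists>j\<in>J. \<exists>t\<in>carrier R. s = j \<oplus> t \<otimes> a \<and> y = t \<otimes> x)" for s
  have \<theta>: "\<theta> (j \<oplus> t \<otimes> a) = t \<otimes> x" if "j \<in> J" "t \<in> carrier R" for j t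
  proof -
    have "\<exists>y. \<exists>j'\<in>J. \<exists>t'\<in>carrier R. j \<oplus> t \<otimes> a = j' \<oplus> t' \<otimes> a \<and> y = t' \<otimes> x"
      using that by blast
    from someI_ex[OF this] obtain j' t' where "j' \<in> J" "t' \<in> carrier R"
      "j \<oplus> t \<otimes> a = j' \<oplus> t' \<otimes> a" "\<theta> (j \<oplus> t \<otimes> a) = t' \<otimes> x"
      unfolding \<theta>_def by blast
    with uniq[of j t j' t'] that show ?thesis by simp
  qed
  show thesis
  proof (rule that)
    fix s assume "s \<in> I"
    then show "\<exists>t\<in>carrier R. \<theta> s = t \<otimes> x" using decomp[OF \<open>s \<in> I\<close>] \<theta> by fastforce
  next
    fix s s' assume "s \<in> I" "s' \<in> I"
    then obtain j t j' t' where *: "j \<in> J" "t \<in> carrier R" "s = j \<oplus> t \<otimes> a"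
      "j' \<in> J" "t' \<in> carrier R" "s' = j' \<oplus> t' \<otimes> a"
      using decomp[of s] decomp[of s'] by blast
    have "j \<in> carrier R" "j' \<in> carrier R" using * J.a_Hcarr by auto
    then have "s \<oplus> s' = (j \<oplus> j') \<oplus> (t \<oplus> t') \<otimes> a"
      unfolding *(3,6) using *(2,5) ac by algebra
    then show "\<theta> (s \<oplus> s') = \<theta> s \<oplus> \<theta> s'"
      using * \<theta> J.a_closed by (simp add: l_distr)
  next
    fix s u assume "s \<in> I" and u: "u \<in> carrier R"
    then obtain j t where *: "j \<in> J" "t \<in> carrier R" "s = j \<oplus> t \<otimes> a" using decomp[of s] by blast
    have "j \<in> carrier R" using * J.a_Hcarr by auto
    then have "u \<otimes> s = u \<otimes> j \<oplus> (u \<otimes> t) \<otimes> a"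
      unfolding *(3) using *(2) ac u by algebra
    then show "\<theta> (u \<otimes> s) = u \<otimes> \<theta> s"
      using * \<theta> u J.I_l_closed by (simp add: m_assoc)
  next
    have "\<theta> (\<zero> \<oplus> \<one> \<otimes> a) = \<one> \<otimes> x" by (rule \<theta>) auto
    then show "x \<in> \<theta> ` I" using a ac by (intro image_eqI[of _ _ a]) auto
  qed
qed

end

lemma (in cring) ideal_criterion:
  assumes "I \<subseteq> carrier R" "\<zero> \<in> I" "\<And>a b. a \<in> I \<Longrightarrow> b \<in> I \<Longrightarrow> a \<oplus> b \<in> I"
    and mult: "\<And>r a. r \<in> carrier R \<Longrightarrow> a \<in> I \<Longrightarrow> r \<otimes> a \<in> I"
  shows "ideal I R"
proof (rule idealI[OF ring_axioms])
  show "subgroup I (add_monoid R)"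
  proof (rule add.subgroupI)
    fix a assume "a \<in> I"
    moreover then have "\<ominus> a = (\<ominus> \<one>) \<otimes> a" using assms(1) by (simp add: subsetD l_minus)
    ultimately show "\<ominus> a \<in> I" using mult[of "\<ominus> \<one>" a] by simp
  qed (use assms in auto)
  show "a \<otimes> r \<in> I" if "a \<in> I" "r \<in> carrier R" for a r
    using mult[OF that(2,1)] that assms(1) by (simp add: m_comm subsetD)
qed (use mult in auto)

section \<open>The idealization by the residue field\<close>

context noetherian_local_ring
begin

abbreviation "S \<equiv> R \<ltimes> quotient_ring_module R \<mm>"

interpretation K: field "R Quot \<mm>"
  by (rule maximalideal.quotient_is_field[OF maximalideal_axioms is_cring])

interpretation S: cring S
  by (rule idealization_cring[OF quotient_ring_module_module[OF is_cring ideal_axioms]])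

lemma residue_closed [simp]: "r \<in> carrier R \<Longrightarrow> \<mm> +> r \<in> carrier (R Quot \<mm>)"
  using ring_hom_closed[OF rcos_ring_hom] .

lemma residue_mult: "r \<in> carrier R \<Longrightarrow> s \<in> carrier R \<Longrightarrow> \<mm> +> (r \<otimes> s) = (\<mm> +> r) \<otimes>\<^bsub>R Quot \<mm>\<^esub> (\<mm> +> s)"
  using ring_hom_mult[OF rcos_ring_hom] .

lemma residue_one: "\<mm> +> \<one> = \<one>\<^bsub>R Quot \<mm>\<^esub>"
  using ring_hom_one[OF rcos_ring_hom] .

lemma residue_eq_zero_iff: "r \<in> carrier R \<Longrightarrow> \<mm> +> r = \<zero>\<^bsub>R Quot \<mm>\<^esub> \<longleftrightarrow> r \<in> \<mm>"
  unfolding FactRing_def using a_rcos_const[of r] a_rcos_self[of r] by force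

lemma residue_surj: "c \<in> carrier (R Quot \<mm>) \<Longrightarrow> \<exists>r\<in>carrier R. c = \<mm> +> r"
  by (auto simp: FactRing_def A_RCOSETS_def')

lemma residue_idealization_simps [simp]:
  "carrier S = carrier R \<times> carrier (R Quot \<mm>)"
  "\<zero>\<^bsub>S\<^esub> = (\<zero>, \<zero>\<^bsub>R Quot \<mm>\<^esub>)" "\<one>\<^bsub>S\<^esub> = (\<one>, \<zero>\<^bsub>R Quot \<mm>\<^esub>)"
  "(r, c) \<oplus>\<^bsub>S\<^esub> (s, d) = (r \<oplus> s, c \<oplus>\<^bsub>R Quot \<mm>\<^esub> d)"
  "(r, c) \<otimes>\<^bsub>S\<^esub> (s, d) =
    (r \<otimes> s, (\<mm> +> r) \<otimes>\<^bsub>R Quot \<mm>\<^esub> d \<oplus>\<^bsub>R Quot \<mm>\<^esub> (\<mm> +> s) \<otimes>\<^bsub>R Quot \<mm>\<^esub> c)"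
  by (simp_all add: idealization_def quotient_ring_module_def ring.defs module.defs)

lemma fst_image_ideal:
  assumes "ideal I S"
  shows "ideal (fst ` I) R"
proof -
  interpret I: ideal I S by fact
  have c: "I \<subseteq> carrier R \<times> carrier (R Quot \<mm>)" using I.a_subset by simp
  show ?thesis
  proof (rule ideal_criterion)
    show "\<zero> \<in> fst ` I" using I.zero_closed by force
  next
    fix a b assume "a \<in> fst ` I" "b \<in> fst ` I"
    then obtain c d where "(a, c) \<in> I" "(b, d) \<in> I" by auto
    from I.a_closed[OF this] show "a \<oplus> b \<in> fst ` I" by force
  next
    fix r a assume r: "r \<in> carrier R" and "a \<in> fst ` I"
    then obtain c where "(a, c) \<in> I" by auto
    from I.I_l_closed[OF this, of "(r, \<zero>\<^bsub>R Quot \<mm>\<^esub>)"] show "r \<otimes> a \<in> fst ` I"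
      using r by force
  qed (use c in auto)
qed

text \<open>An ideal of \<open>S\<close> is an extension of its image in \<open>R\<close>, which is
  finitely generated, by its part inside \<open>0 \<times> k\<close>, which is zero or everything
  because \<open>k\<close> is a field. Lifted generators of the image together with generators of
  that part suffice.\<close>

lemma residue_idealization_noetherian: "noetherian_ring S"
proof (rule S.noetherian_ringI)
  fix I assume I: "ideal I S"
  interpret I: ideal I S by fact
  have Ic: "I \<subseteq> carrier R \<times> carrier (R Quot \<mm>)" using I.a_subset by simp
  \<comment> \<open>\<open>Y\<close> has at most one element: a nonzero \<open>(\<zero>, c)\<close>
    generates all of \<open>0 \<times> k\<close>, since \<open>c\<close> is invertible and every
    residue class lifts to \<open>R\<close>.\<close>
  obtain Y where Y: "finite Y" "Y \<subseteq> I" "\<And>c. (\<zero>, c) \<in> I \<Longrightarrow> (\<zero>, c) \<in> Idl\<^bsub>S\<^esub> Y"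
  proof (cases "\<exists>c. c \<noteq> \<zero>\<^bsub>R Quot \<mm>\<^esub> \<and> (\<zero>, c) \<in> I")
    case True
    then obtain c where c: "c \<noteq> \<zero>\<^bsub>R Quot \<mm>\<^esub>" "(\<zero>, c) \<in> I" by blast
    then have cc: "c \<in> carrier (R Quot \<mm>)" using Ic by auto
    interpret C: ideal "Idl\<^bsub>S\<^esub> {(\<zero>, c)}" S by (rule S.genideal_ideal) (use cc in auto)
    have "(\<zero>, d) \<in> Idl\<^bsub>S\<^esub> {(\<zero>, c)}" if d: "d \<in> carrier (R Quot \<mm>)" for d
    proof -
      have u: "c \<in> Units (R Quot \<mm>)" using c(1) cc K.field_Units by auto
      then obtain r where r: "r \<in> carrier R" "d \<otimes>\<^bsub>R Quot \<mm>\<^esub> inv\<^bsub>R Quot \<mm>\<^esub> c = \<mm> +> r"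
        using residue_surj[of "d \<otimes>\<^bsub>R Quot \<mm>\<^esub> inv\<^bsub>R Quot \<mm>\<^esub> c"] d by auto
      have "(r, \<zero>\<^bsub>R Quot \<mm>\<^esub>) \<otimes>\<^bsub>S\<^esub> (\<zero>, c) = (\<zero>, d)"
        using r(1) u d cc by (simp add: r(2)[symmetric] K.m_assoc)
      moreover have "(\<zero>, c) \<in> Idl\<^bsub>S\<^esub> {(\<zero>, c)}" by (rule S.genideal_self') (use cc in auto)
      ultimately show ?thesis
        using C.I_l_closed[of "(\<zero>, c)" "(r, \<zero>\<^bsub>R Quot \<mm>\<^esub>)"] r(1) by simp
    qed
    then show thesis using Ic c by (intro that[of "{(\<zero>, c)}"]) auto
  next
    case False
    moreover have "\<zero>\<^bsub>S\<^esub> \<in> Idl\<^bsub>S\<^esub> {}"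
      by (rule additive_subgroup.zero_closed[OF ideal.axioms(1)[OF S.genideal_ideal]]) simp
    ultimately show thesis by (intro that[of "{}"]) (simp, simp, metis residue_idealization_simps(2))
  qed
  obtain A where A: "A \<subseteq> carrier R" "finite A" "fst ` I = Idl A"
    using finetely_gen[OF fst_image_ideal[OF I]] by blast
  have "A \<subseteq> fst ` I" using A genideal_self by simp
  then obtain L where L: "finite L" "L \<subseteq> I" "fst ` L = A"
    using A(2) finite_subset_image by metis
  have LY: "L \<union> Y \<subseteq> carrier S" using L(2) Y(2) Ic by auto
  let ?G = "Idl\<^bsub>S\<^esub> (L \<union> Y)"
  interpret G: ideal ?G S by (rule S.genideal_ideal[OF LY])
  have GI: "?G \<subseteq> I" using S.genideal_minimal[OF I] L Y by simp
  have YG: "Idl\<^bsub>S\<^esub> Y \<subseteq> ?G"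
    using LY by (intro S.genideal_minimal[OF G.ideal_axioms]) (use S.genideal_self[OF LY] in auto)
  have "fst ` I \<subseteq> fst ` ?G"
    unfolding A(3) using L(3) S.genideal_self[OF LY]
    by (intro genideal_minimal fst_image_ideal G.ideal_axioms) auto
  have "I \<subseteq> ?G"
  proof
    fix s assume s: "s \<in> I"
    with \<open>fst ` I \<subseteq> fst ` ?G\<close> have "fst s \<in> fst ` ?G" by blast
    then obtain t where t: "t \<in> ?G" "fst t = fst s" by fastforce
    have c: "s \<in> carrier S" "t \<in> carrier S" using s t GI I.a_subset by auto
    \<comment> \<open>Subtracting an element of \<open>?G\<close> with the same first component
      leaves an element of \<open>I\<close> in \<open>0 \<times> k\<close>, which \<open>Y\<close>
      takes care of.\<close>
    have "s \<ominus>\<^bsub>S\<^esub> t \<in> I" using s t GI unfolding a_minus_def by (intro I.a_closed I.a_inv_closed) auto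
    moreover have "fst (s \<ominus>\<^bsub>S\<^esub> t) = \<zero>"
    proof -
      have "s = (s \<ominus>\<^bsub>S\<^esub> t) \<oplus>\<^bsub>S\<^esub> t" using c by algebra
      moreover have "s \<ominus>\<^bsub>S\<^esub> t \<in> carrier S" using c by blast
      ultimately have "fst s = fst (s \<ominus>\<^bsub>S\<^esub> t) \<oplus> fst t" "fst (s \<ominus>\<^bsub>S\<^esub> t) \<in> carrier R"
        by (metis residue_idealization_simps(4) fst_conv prod.collapse) (use \<open>s \<ominus>\<^bsub>S\<^esub> t \<in> carrier S\<close> in auto)
      then show ?thesis using t(2) c by (auto simp: add.r_cancel_one')
    qed
    ultimately have "s \<ominus>\<^bsub>S\<^esub> t \<in> Idl\<^bsub>S\<^esub> Y" using Y(3) by (metis prod.collapse)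
    then have "(s \<ominus>\<^bsub>S\<^esub> t) \<oplus>\<^bsub>S\<^esub> t \<in> ?G" using YG t by (intro G.a_closed) auto
    moreover have "s = (s \<ominus>\<^bsub>S\<^esub> t) \<oplus>\<^bsub>S\<^esub> t" using c by algebra
    ultimately show "s \<in> ?G" by simp
  qed
  then show "\<exists>A\<subseteq>carrier S. finite A \<and> I = Idl\<^bsub>S\<^esub> A"
    using GI L(1) Y(1) LY by (intro exI[of _ "L \<union> Y"]) auto
qed

text \<open>The product of \<open>(r, c)\<close> with \<open>x = (\<zero>, \<one>)\<close> is zero
  in the first component and the class of \<open>r\<close> in the second. Hence the annihilator of
  \<open>x\<close> is \<open>\<mm> \<times> k\<close>, and everything outside it has a unit as first
  component.\<close>

lemma split_socle_residue_idealization: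
  "split_socle S (\<zero>, \<one>\<^bsub>R Quot \<mm>\<^esub>) (\<lambda>(r, c). (\<zero>, c))"
proof -
  interpret noetherian_ring S by (rule residue_idealization_noetherian)
  let ?x = "(\<zero>, \<one>\<^bsub>R Quot \<mm>\<^esub>)"
  have z [simp]: "\<mm> +> \<zero> = \<zero>\<^bsub>R Quot \<mm>\<^esub>" by (simp add: residue_eq_zero_iff)
  have ann: "(r, c) \<otimes>\<^bsub>S\<^esub> ?x = \<zero>\<^bsub>S\<^esub> \<longleftrightarrow> r \<in> \<mm>" if "r \<in> carrier R" "c \<in> carrier (R Quot \<mm>)" for r c
    using that by (simp add: residue_eq_zero_iff)
  show ?thesis
  proof
    show "?x \<in> carrier S" "?x \<otimes>\<^bsub>S\<^esub> ?x = \<zero>\<^bsub>S\<^esub>" "?x \<noteq> \<zero>\<^bsub>S\<^esub>" "(\<lambda>(r, c). (\<zero>, c)) ?x = ?x"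
      using K.one_not_zero by auto
  next
    fix s assume s: "s \<in> carrier S" "s \<otimes>\<^bsub>S\<^esub> ?x \<noteq> \<zero>\<^bsub>S\<^esub>"
    then obtain r c where rc: "s = (r, c)" "r \<in> carrier R" "c \<in> carrier (R Quot \<mm>)" "r \<notin> \<mm>"
      using ann by (cases s) auto
    then have u: "r \<in> Units R" by (intro Units_if_not_mem)
    let ?u = "\<mm> +> r" and ?v = "\<mm> +> inv r"
    have v: "?u \<otimes>\<^bsub>R Quot \<mm>\<^esub> ?v = \<one>\<^bsub>R Quot \<mm>\<^esub>"
      using u rc by (simp add: residue_mult[symmetric] residue_one)
    \<comment> \<open>The inverse of \<open>(r, c)\<close> is formally
      \<open>(1/r, -c/r^2)\<close>.\<close>
    let ?t = "(inv r, \<ominus>\<^bsub>R Quot \<mm>\<^esub> (?v \<otimes>\<^bsub>R Quot \<mm>\<^esub> (?v \<otimes>\<^bsub>R Quot \<mm>\<^esub> c)))"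
    have "?u \<otimes>\<^bsub>R Quot \<mm>\<^esub> (?v \<otimes>\<^bsub>R Quot \<mm>\<^esub> (?v \<otimes>\<^bsub>R Quot \<mm>\<^esub> c)) = ?v \<otimes>\<^bsub>R Quot \<mm>\<^esub> c"
      using u rc v by (simp add: K.m_assoc[symmetric])
    then have "s \<otimes>\<^bsub>S\<^esub> ?t = \<one>\<^bsub>S\<^esub>"
      using u rc by (simp add: K.r_minus K.l_neg)
    moreover have "?t \<in> carrier S" using u rc by simp
    ultimately show "s \<in> Units S" using s(1) S.m_comm[of s ?t] unfolding Units_def by auto
  next
    fix s assume s: "s \<in> carrier S"
    then obtain r where "r \<in> carrier R" "snd s = \<mm> +> r" using residue_surj by (cases s) auto
    then show "\<exists>t\<in>carrier S. (\<lambda>(r, c). (\<zero>, c)) s = t \<otimes>\<^bsub>S\<^esub> ?x"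
      using s by (cases s, intro bexI[of _ "(r, \<zero>\<^bsub>R Quot \<mm>\<^esub>)"]) simp_all
  next
    \<comment> \<open>Linearity holds on the annihilator only: the first component of
      \<open>s\<close> lies in \<open>\<mm>\<close>, so its contribution to the second component of
      \<open>t \<otimes> s\<close> vanishes.\<close>
    fix s t assume "s \<in> carrier S" "s \<otimes>\<^bsub>S\<^esub> ?x = \<zero>\<^bsub>S\<^esub>" "t \<in> carrier S"
    then show "(\<lambda>(r, c). (\<zero>, c)) (t \<otimes>\<^bsub>S\<^esub> s) = t \<otimes>\<^bsub>S\<^esub> (\<lambda>(r, c). (\<zero>, c)) s"
      using ann[of "fst s" "snd s"] by (cases s; cases t) (simp add: iffD2[OF residue_eq_zero_iff])
  next
    fix s t assume "s \<in> carrier S" "t \<in> carrier S"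
    then show "(\<lambda>(r, c). (\<zero>, c)) (s \<oplus>\<^bsub>S\<^esub> t) = (\<lambda>(r, c). (\<zero>, c)) s \<oplus>\<^bsub>S\<^esub> (\<lambda>(r, c). (\<zero>, c)) t"
      by (cases s; cases t) auto
  qed
qed

end

section \<open>Ext and the standard resolution\<close>

lemma regular_module_simps [simp]:
  "carrier (regular_module R) = carrier R" "\<zero>\<^bsub>regular_module R\<^esub> = \<zero>\<^bsub>R\<^esub>"
  "a \<oplus>\<^bsub>regular_module R\<^esub> b = a \<oplus>\<^bsub>R\<^esub> b" "a \<odot>\<^bsub>regular_module R\<^esub> b = a \<otimes>\<^bsub>R\<^esub> b"
  by (simp_all add: regular_module_def)

lemma free_on_simps:
  "\<zero>\<^bsub>free_on R X\<^esub> = (\<lambda>x. \<zero>\<^bsub>R\<^esub>)"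
  "f \<oplus>\<^bsub>free_on R X\<^esub> g = (\<lambda>x. f x \<oplus>\<^bsub>R\<^esub> g x)"
  "r \<odot>\<^bsub>free_on R X\<^esub> f = (\<lambda>x. r \<otimes>\<^bsub>R\<^esub> f x)"
  by (simp_all add: free_on_def)

lemma res_mod_simps [simp]:
  "\<zero>\<^bsub>res_mod R M n\<^esub> = (\<lambda>x. \<zero>\<^bsub>R\<^esub>)"
  "f \<oplus>\<^bsub>res_mod R M n\<^esub> g = (\<lambda>x. f x \<oplus>\<^bsub>R\<^esub> g x)"
  "r \<odot>\<^bsub>res_mod R M n\<^esub> f = (\<lambda>x. r \<otimes>\<^bsub>R\<^esub> f x)"
  by (simp_all add: res_mod_def free_on_simps)

lemma (in cring) res_mod_module: "module R (res_mod R M n)"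
  unfolding res_mod_def by (rule free_on_module[OF is_cring])

lemma module_hom_zero:
  assumes "module R M" "module R N" "f \<in> module_hom R M N"
  shows "f \<zero>\<^bsub>M\<^esub> = \<zero>\<^bsub>N\<^esub>"
  by (rule mod_hom.f0_is_0[where R = R]) (intro mod_hom.intro mod_hom_axioms.intro assms)

text \<open>By exactness a cocycle \<open>f\<close> is a homomorphism to \<open>N\<close> from the
  syzygy contained in \<open>res_mod R M j\<close>. Vanishing of Ext makes \<open>f\<close> a
  coboundary, that is, this homomorphism extends to the whole free module.\<close>

lemma (in module) Ext_trivial_extend:
  assumes N: "module R N" and triv: "trivial_group (Ext R (Suc j) M N)"
    and f: "f \<in> module_hom R (res_mod R M (Suc j)) N"
    and cocycle: "\<And>v. v \<in> carrier (res_mod R M (Suc (Suc j))) \<Longrightarrow> f (res_diff R v) = \<zero>\<^bsub>N\<^esub>"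
  obtains g where "g \<in> module_hom R (res_mod R M j) N"
    "\<And>v. v \<in> carrier (res_mod R M (Suc j)) \<Longrightarrow> g (res_diff R v) = f v"
proof -
  interpret N: module R N by fact
  interpret P: module R "res_mod R M (Suc j)" by (rule res_mod_module)
  let ?P = "res_mod R M" and ?d = "\<lambda>_::nat. res_diff R"
  let ?H = "hom_group R (?P (Suc j)) N"
  let ?Z = "cocycles R ?P ?d N (Suc j)" and ?B = "coboundaries R ?P ?d N (Suc j)"
  let ?f = "restrict f (carrier (?P (Suc j)))"
  have dc: "v \<in> carrier (?P (Suc n)) \<Longrightarrow> res_diff R v \<in> carrier (?P n)" for v n
    using res_exact(4)[of n] by (auto dest: module_hom_closed)
  have fH: "?f \<in> carrier ?H"
    using f P.M.add.m_closed P.smult_closed unfolding hom_group_def module_hom_def by auto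
  have fZ: "?f \<in> ?Z"
    using fH cocycle dc[of _ "Suc j"] unfolding cocycles_def by auto
  have "carrier (Ext R (Suc j) M N) = {?B}"
    using triv unfolding trivial_group_def Ext_def hom_cohomology_def FactGroup_def by simp
  then have eq: "?B #>\<^bsub>?H\<lparr>carrier := ?Z\<rparr>\<^esub> ?f = ?B"
    using fZ unfolding Ext_def hom_cohomology_def FactGroup_def RCOSETS_def by auto
  \<comment> \<open>Since the zero cochain is a coboundary, \<open>?f\<close> belongs to its own
    coset, and by \<open>eq\<close> that coset is \<open>?B\<close>.\<close>
  have one: "(\<lambda>v\<in>carrier (?P (Suc j)). \<zero>\<^bsub>N\<^esub>) \<in> ?B"
  proof -
    have "(\<lambda>v\<in>carrier (?P j). \<zero>\<^bsub>N\<^esub>) \<in> carrier (hom_group R (?P j) N)"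
    proof -
      interpret Pj: module R "res_mod R M j" by (rule res_mod_module)
      show ?thesis using Pj.M.add.m_closed Pj.smult_closed by (auto simp: hom_group_def module_hom_def)
    qed
    then show ?thesis
      unfolding coboundaries_def nat.case using dc[of _ j]
      by (intro image_eqI[of _ _ "\<lambda>v\<in>carrier (?P j). \<zero>\<^bsub>N\<^esub>"] restrict_ext) simp_all
  qed
  have "?f \<in> ?B #>\<^bsub>?H\<lparr>carrier := ?Z\<rparr>\<^esub> ?f"
    unfolding r_coset_def using funcset_mem[OF module_hom_closed[OF f]]
    by (auto simp: hom_group_def intro!: bexI[OF _ one] restrict_ext)
  with eq obtain g where g: "g \<in> carrier (hom_group R (?P j) N)"
    "?f = (\<lambda>v\<in>carrier (?P (Suc j)). g (res_diff R v))"
    unfolding coboundaries_def by auto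
  show thesis
  proof (rule that)
    show "g \<in> module_hom R (?P j) N" using g(1) by (simp add: hom_group_def)
    show "g (res_diff R v) = f v" if "v \<in> carrier (?P (Suc j))" for v
      using fun_cong[OF g(2), of v] that by simp
  qed
qed

section \<open>Homomorphisms out of free modules\<close>

lemma (in module) free_on_hom_expand:
  assumes h: "h \<in> module_hom R (free_on R X) M" and f: "f \<in> carrier (free_on R X)"
  shows "h f = (\<Oplus>\<^bsub>M\<^esub>b\<in>{b. f b \<noteq> \<zero>}. f b \<odot>\<^bsub>M\<^esub> h (unit_vec_on R b))"
proof -
  interpret F: module R "free_on R X" by (rule free_on_module) (rule is_cring)
  interpret H: mod_hom R "free_on R X" M h by unfold_locales (rule h)
  let ?S = "{b. f b \<noteq> \<zero>}"
  have S: "finite ?S" "?S \<subseteq> X" and c: "f b \<in> carrier R" for b using f by (auto simp: free_on_def)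
  have u: "unit_vec_on R b \<in> carrier (free_on R X)" if "b \<in> ?S" for b
    using unit_vec_on_carrier[of b X] S that by blast
  have uc: "f b \<odot>\<^bsub>free_on R X\<^esub> unit_vec_on R b \<in> carrier (free_on R X)" if "b \<in> ?S" for b
    using F.smult_closed[OF c u[OF that]] .
  have "f = (\<Oplus>\<^bsub>free_on R X\<^esub>b\<in>?S. f b \<odot>\<^bsub>free_on R X\<^esub> unit_vec_on R b)"
  proof
    fix y
    have "(\<Oplus>\<^bsub>free_on R X\<^esub>b\<in>?S. f b \<odot>\<^bsub>free_on R X\<^esub> unit_vec_on R b) y
        = (\<Oplus>b\<in>?S. (f b \<odot>\<^bsub>free_on R X\<^esub> unit_vec_on R b) y)"
      using uc by (intro free_on_finsum S(1)) blast
    also have "\<dots> = (\<Oplus>b\<in>?S. if y = b then f b else \<zero>)"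
      by (rule R.finsum_cong') (use c in \<open>simp_all add: free_on_def unit_vec_on_def\<close>)
    also have "\<dots> = f y"
    proof (cases "y \<in> ?S")
      case True
      then show ?thesis by (intro R.add.finprod_singleton) (use S c in auto)
    next
      case False
      then have "(\<Oplus>b\<in>?S. if y = b then f b else \<zero>) = (\<Oplus>b\<in>?S. \<zero>)"
        by (intro R.finsum_cong') auto
      with False show ?thesis by simp
    qed
    finally show "f y = (\<Oplus>\<^bsub>free_on R X\<^esub>b\<in>?S. f b \<odot>\<^bsub>free_on R X\<^esub> unit_vec_on R b) y" ..
  qed
  then have "h f = h (\<Oplus>\<^bsub>free_on R X\<^esub>b\<in>?S. f b \<odot>\<^bsub>free_on R X\<^esub> unit_vec_on R b)" by (rule arg_cong)
  also have "\<dots> = (\<Oplus>\<^bsub>M\<^esub>b\<in>?S. h (f b \<odot>\<^bsub>free_on R X\<^esub> unit_vec_on R b))"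
    using S(1) uc
  proof (induction rule: finite_induct)
    case (insert a A)
    moreover then have "(\<lambda>b. f b \<odot>\<^bsub>free_on R X\<^esub> unit_vec_on R b) \<in> A \<rightarrow> carrier (free_on R X)" by blast
    moreover have "h (f b \<odot>\<^bsub>free_on R X\<^esub> unit_vec_on R b) \<in> carrier M" if "b \<in> insert a A" for b
      using insert.prems that by auto
    ultimately show ?case by (simp add: Pi_iff)
  qed simp
  also have "\<dots> = (\<Oplus>\<^bsub>M\<^esub>b\<in>?S. f b \<odot>\<^bsub>M\<^esub> h (unit_vec_on R b))"
    using c u by (intro M.finsum_cong') (auto simp del: mem_Collect_eq)
  finally show ?thesis .
qed

lemma (in module) free_on_hom_eqI:
  assumes "g \<in> module_hom R (free_on R X) M" "h \<in> module_hom R (free_on R X) M"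
    and eq: "\<And>b. b \<in> X \<Longrightarrow> g (unit_vec_on R b) = h (unit_vec_on R b)"
    and f: "f \<in> carrier (free_on R X)"
  shows "g f = h f"
  unfolding free_on_hom_expand[OF assms(1) f] free_on_hom_expand[OF assms(2) f]
proof (rule M.finsum_cong')
  have S: "{b. f b \<noteq> \<zero>} \<subseteq> X" and c: "f b \<in> carrier R" for b using f by (auto simp: free_on_def)
  show "(\<lambda>b. f b \<odot>\<^bsub>M\<^esub> h (unit_vec_on R b)) \<in> {b. f b \<noteq> \<zero>} \<rightarrow> carrier M"
  proof (intro funcsetI smult_closed c)
    fix b assume "b \<in> {b. f b \<noteq> \<zero>}"
    with S have "unit_vec_on R b \<in> carrier (free_on R X)" by (intro unit_vec_on_carrier) blast
    then show "h (unit_vec_on R b) \<in> carrier M" using module_hom_closed[OF assms(2)] by blast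
  qed
  show "f b \<odot>\<^bsub>M\<^esub> g (unit_vec_on R b) = f b \<odot>\<^bsub>M\<^esub> h (unit_vec_on R b)" if "b \<in> {b. f b \<noteq> \<zero>}" for b
    using eq S that by auto
qed simp

lemma (in module) free_on_hom_ex:
  assumes v: "v \<in> X \<rightarrow> carrier M"
  obtains h where "h \<in> module_hom R (free_on R X) M" "\<And>b. b \<in> X \<Longrightarrow> h (unit_vec_on R b) = v b"
proof (rule that[OF lin_ext_hom[OF v]])
  show "(\<Oplus>\<^bsub>M\<^esub>b\<in>{b. unit_vec_on R x b \<noteq> \<zero>}. unit_vec_on R x b \<odot>\<^bsub>M\<^esub> v b) = v x" if "x \<in> X" for x
    using that v by (intro lin_ext_unit_vec) auto
qed

text \<open>Projectivity of a free module, applied to multiplication by \<open>x\<close> from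
  \<open>R\<close> onto the ideal generated by \<open>x\<close>: preimages are chosen on the basis
  and extended linearly.\<close>

lemma (in cring) free_on_lift_mult:
  assumes x: "x \<in> carrier R"
    and h: "h \<in> module_hom R (free_on R X) (regular_module R)"
    and mult: "\<And>v. v \<in> carrier (free_on R X) \<Longrightarrow> \<exists>t\<in>carrier R. h v = t \<otimes> x"
  obtains g where "g \<in> module_hom R (free_on R X) (regular_module R)"
    "\<And>v. v \<in> carrier (free_on R X) \<Longrightarrow> g v \<otimes> x = h v"
proof -
  interpret A: module R "regular_module R" by (rule regular_module_module[OF is_cring])
  have "\<forall>b\<in>X. \<exists>t\<in>carrier R. h (unit_vec_on R b) = t \<otimes> x"
    by (intro ballI mult unit_vec_on_carrier)
  then obtain t where t: "\<And>b. b \<in> X \<Longrightarrow> t b \<in> carrier R" "\<And>b. b \<in> X \<Longrightarrow> h (unit_vec_on R b) = t b \<otimes> x"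
    by metis
  then have "t \<in> X \<rightarrow> carrier (regular_module R)" by simp
  then obtain g where g: "g \<in> module_hom R (free_on R X) (regular_module R)"
      "\<And>b. b \<in> X \<Longrightarrow> g (unit_vec_on R b) = t b"
    using A.free_on_hom_ex by blast
  have "(\<lambda>v. g v \<otimes> x) \<in> module_hom R (free_on R X) (regular_module R)"
    using g(1) x by (auto simp: module_hom_def Pi_iff l_distr m_assoc)
  from A.free_on_hom_eqI[OF this h] have "g v \<otimes> x = h v" if "v \<in> carrier (free_on R X)" for v
    using g(2) t(2) that by simp
  with g(1) show thesis by (rule that)
qed

section \<open>Functionals on syzygies\<close>

context split_socle
begin

text \<open>Since \<open>h\<close> vanishes on the kernel of the differential, it stands for a functional on the syzygy
  \<open>res_diff R ` carrier (res_mod R M (Suc k))\<close>, with values in the ideal generated by \<open>x\<close> and value \<open>x\<close> at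
  \<open>res_diff R p\<close>.\<close>

definition syzygy_functional ::
  "('a, 'm, 'd) module_scheme \<Rightarrow> nat \<Rightarrow> ((('a, 'm) res_basis \<Rightarrow> 'a) \<Rightarrow> 'a) \<Rightarrow> (('a, 'm) res_basis \<Rightarrow> 'a) \<Rightarrow> bool"
  where "syzygy_functional M k h p \<longleftrightarrow>
    h \<in> module_hom R (res_mod R M (Suc k)) (regular_module R) \<and>
    (\<forall>v\<in>carrier (res_mod R M (Suc (Suc k))). h (res_diff R v) = \<zero>) \<and>
    (\<forall>v\<in>carrier (res_mod R M (Suc k)). \<exists>t\<in>carrier R. h v = t \<otimes> x) \<and>
    p \<in> carrier (res_mod R M (Suc k)) \<and> h p = x \<and>
    x \<odot>\<^bsub>res_mod R M k\<^esub> res_diff R p = \<zero>\<^bsub>res_mod R M k\<^esub>"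

text \<open>Here \<open>g\<close> lifts \<open>h\<close> along multiplication by \<open>x\<close>.
  As \<open>h\<close> vanishes on the next syzygy, \<open>g\<close> maps that syzygy into the
  annihilator of \<open>x\<close>, where \<open>\<pi>\<close> is available. The multiple of
  \<open>p\<close> by \<open>x\<close> lies in the next syzygy because the differential sends it to
  \<open>x\<close> times \<open>res_diff R p\<close>, which is zero.\<close>

lemma syzygy_functional_lift:
  assumes M: "module R M" and h: "syzygy_functional M k h p"
  obtains g where "g \<in> module_hom R (res_mod R M (Suc k)) (regular_module R)"
    "\<And>v. v \<in> carrier (res_mod R M (Suc (Suc k))) \<Longrightarrow> g (res_diff R v) \<in> carrier R \<and> g (res_diff R v) \<otimes> x = \<zero>"
    "g p \<in> carrier R" "g p \<otimes> x = x" "x \<odot>\<^bsub>res_mod R M (Suc k)\<^esub> p \<in> res_diff R ` carrier (res_mod R M (Suc (Suc k)))"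
proof -
  interpret module R M by fact
  interpret P: module R "res_mod R M (Suc k)" by (rule res_mod_module)
  interpret P0: module R "res_mod R M k" by (rule res_mod_module)
  obtain g where g: "g \<in> module_hom R (res_mod R M (Suc k)) (regular_module R)"
    "\<And>v. v \<in> carrier (res_mod R M (Suc k)) \<Longrightarrow> g v \<otimes> x = h v"
  proof (rule free_on_lift_mult[OF x_closed])
    show "h \<in> module_hom R (free_on R (res_basis_set R M (Suc k))) (regular_module R)"
      "\<And>v. v \<in> carrier (free_on R (res_basis_set R M (Suc k))) \<Longrightarrow> \<exists>t\<in>carrier R. h v = t \<otimes> x"
      using h unfolding syzygy_functional_def res_mod_def by blast+
  qed (simp add: res_mod_def)
  have gc: "g v \<in> carrier R" if "v \<in> carrier (res_mod R M (Suc k))" for v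
    using module_hom_closed[OF g(1)] that by auto
  have dc: "v \<in> carrier (res_mod R M (Suc n)) \<Longrightarrow> res_diff R v \<in> carrier (res_mod R M n)" for v n
    using res_exact(4)[of n] by (auto dest: module_hom_closed)
  have p: "p \<in> carrier (res_mod R M (Suc k))" "x \<odot>\<^bsub>res_mod R M k\<^esub> res_diff R p = \<zero>\<^bsub>res_mod R M k\<^esub>"
    using h unfolding syzygy_functional_def by auto
  show thesis
  proof (rule that[OF g(1)])
    show "g (res_diff R v) \<in> carrier R \<and> g (res_diff R v) \<otimes> x = \<zero>"
      if "v \<in> carrier (res_mod R M (Suc (Suc k)))" for v
      using h g(2) gc dc[OF that] that unfolding syzygy_functional_def by simp
    show "g p \<in> carrier R" "g p \<otimes> x = x" using h g(2) gc unfolding syzygy_functional_def by auto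
    have "res_diff R (x \<odot>\<^bsub>res_mod R M (Suc k)\<^esub> p) = \<zero>\<^bsub>res_mod R M k\<^esub>"
      using module_hom_smult[OF res_exact(4) x_closed p(1)] p(2) by simp
    then show "x \<odot>\<^bsub>res_mod R M (Suc k)\<^esub> p \<in> res_diff R ` carrier (res_mod R M (Suc (Suc k)))"
      unfolding res_exact(6) using P.smult_closed[OF x_closed p(1)] by blast
  qed
qed

text \<open>The new functional is \<open>\<pi>\<close> after \<open>g\<close> on the next syzygy,
  and \<open>p'\<close> is chosen over \<open>x\<close> times \<open>p\<close>. Its value there is
  \<open>\<pi> (x \<otimes> g p) = \<pi> x = x\<close>. The element and the functional together
  split a copy of the residue field off that syzygy.\<close>

lemma syzygy_functional_Suc:
  assumes M: "module R M" and h: "syzygy_functional M k h p"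
  obtains h' p' where "syzygy_functional M (Suc k) h' p'"
    "\<And>s. s \<in> carrier R \<Longrightarrow> s \<otimes> x = \<zero> \<Longrightarrow>
      s \<odot>\<^bsub>res_mod R M (Suc k)\<^esub> res_diff R p' = \<zero>\<^bsub>res_mod R M (Suc k)\<^esub>"
proof -
  interpret module R M by fact
  interpret P: module R "res_mod R M (Suc k)" by (rule res_mod_module)
  interpret P2: module R "res_mod R M (Suc (Suc k))" by (rule res_mod_module)
  let ?P = "res_mod R M" and ?d = "res_diff R"
  obtain g where g: "g \<in> module_hom R (?P (Suc k)) (regular_module R)"
    and gd: "\<And>v. v \<in> carrier (?P (Suc (Suc k))) \<Longrightarrow> g (?d v) \<in> carrier R \<and> g (?d v) \<otimes> x = \<zero>"
    and gp: "g p \<in> carrier R" "g p \<otimes> x = x"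
    and xp: "x \<odot>\<^bsub>?P (Suc k)\<^esub> p \<in> ?d ` carrier (?P (Suc (Suc k)))"
    using syzygy_functional_lift[OF M h] by blast
  have pc: "p \<in> carrier (?P (Suc k))" using h unfolding syzygy_functional_def by auto
  have dc: "v \<in> carrier (?P (Suc n)) \<Longrightarrow> ?d v \<in> carrier (?P n)" for v n
    using res_exact(4)[of n] by (auto dest: module_hom_closed)
  obtain p' where p': "p' \<in> carrier (?P (Suc (Suc k)))" "?d p' = x \<odot>\<^bsub>?P (Suc k)\<^esub> p"
    using xp by (metis imageE)
  \<comment> \<open>The gain over the previous level: a multiple of \<open>x\<close> is killed by
    the whole annihilator of \<open>x\<close>, not merely by \<open>x\<close>.\<close>
  have ann: "s \<odot>\<^bsub>?P (Suc k)\<^esub> ?d p' = \<zero>\<^bsub>?P (Suc k)\<^esub>" if "s \<in> carrier R" "s \<otimes> x = \<zero>" for s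
    unfolding p'(2) P.smult_assoc1[OF that(1) x_closed pc, symmetric] that(2)
    by (rule P.smult_l_null[OF pc])
  interpret D: mod_hom R "?P (Suc (Suc k))" "?P (Suc k)" ?d
    by unfold_locales (rule res_exact)
  define h' where "h' v = \<pi> (g (?d v))" for v
  have "syzygy_functional M (Suc k) h' p'"
    unfolding syzygy_functional_def
  proof (intro conjI ballI)
    show "h' \<in> module_hom R (?P (Suc (Suc k))) (regular_module R)"
      unfolding module_hom_def h'_def
    proof (intro CollectI conjI allI impI funcsetI; (elim conjE)?)
      fix v assume "v \<in> carrier (?P (Suc (Suc k)))"
      then show "\<pi> (g (?d v)) \<in> carrier (regular_module R)" using gd proj_closed by simp
    next
      fix v w assume v: "v \<in> carrier (?P (Suc (Suc k)))" "w \<in> carrier (?P (Suc (Suc k)))"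
      have "g (?d (v \<oplus>\<^bsub>?P (Suc (Suc k))\<^esub> w)) = g (?d v) \<oplus> g (?d w)"
        using module_hom_add[OF g dc dc] v by (simp only: D.f_add regular_module_simps)
      then show "\<pi> (g (?d (v \<oplus>\<^bsub>?P (Suc (Suc k))\<^esub> w))) = \<pi> (g (?d v)) \<oplus>\<^bsub>regular_module R\<^esub> \<pi> (g (?d w))"
        using gd v proj_add by simp
    next
      fix r v assume v: "r \<in> carrier R" "v \<in> carrier (?P (Suc (Suc k)))"
      have "g (?d (r \<odot>\<^bsub>?P (Suc (Suc k))\<^esub> v)) = r \<otimes> g (?d v)"
        using module_hom_smult[OF g _ dc] v by (simp only: D.f_smult regular_module_simps)
      then show "\<pi> (g (?d (r \<odot>\<^bsub>?P (Suc (Suc k))\<^esub> v))) = r \<odot>\<^bsub>regular_module R\<^esub> \<pi> (g (?d v))"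
        using gd v proj_mult by simp
    qed
  next
    fix v assume "v \<in> carrier (?P (Suc (Suc (Suc k))))"
    then have "?d (?d v) = \<zero>\<^bsub>?P (Suc k)\<^esub>" using res_exact(6)[of "Suc k"] by blast
    moreover have "g \<zero>\<^bsub>?P (Suc k)\<^esub> = \<zero>"
      using module_hom_zero[OF P.module_axioms regular_module_module[OF is_cring] g] by simp
    moreover have "\<pi> \<zero> = \<zero>" using proj_mult[of \<zero> \<zero>] proj_closed[of \<zero>] by simp
    ultimately show "h' (?d v) = \<zero>" unfolding h'_def by simp
  next
    fix v assume "v \<in> carrier (?P (Suc (Suc k)))"
    then show "\<exists>t\<in>carrier R. h' v = t \<otimes> x" unfolding h'_def using gd proj_multiple by simp
  next
    show "p' \<in> carrier (?P (Suc (Suc k)))" by (rule p')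
    have "g (?d p') = x \<otimes> g p" using module_hom_smult[OF g x_closed pc] unfolding p'(2) by simp
    also have "\<dots> = x" using gp by (simp add: m_comm)
    finally show "h' p' = x" unfolding h'_def by (simp add: proj_x)
    show "x \<odot>\<^bsub>?P (Suc k)\<^esub> ?d p' = \<zero>\<^bsub>?P (Suc k)\<^esub>" by (rule ann[OF x_closed x_square])
  qed
  with ann show thesis using that by blast
qed

text \<open>The element \<open>y\<close> defines a homomorphism from the next syzygy to
  \<open>N\<close> that sends \<open>x\<close> times \<open>p\<close> to \<open>y\<close>.
  Triviality of Ext extends it to a map \<open>G\<close> on the free module, and \<open>z\<close> is
  \<open>G p\<close>.\<close>

lemma socle_divisible_if_Ext_trivial:
  assumes M: "module R M" and N: "module R N" and h: "syzygy_functional M k h p"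
    and ann: "\<And>s. s \<in> carrier R \<Longrightarrow> s \<otimes> x = \<zero> \<Longrightarrow>
      s \<odot>\<^bsub>res_mod R M k\<^esub> res_diff R p = \<zero>\<^bsub>res_mod R M k\<^esub>"
    and ext: "trivial_group (Ext R (Suc (Suc k)) M N)"
    and y: "y \<in> carrier N" "\<And>s. s \<in> carrier R \<Longrightarrow> s \<otimes> x = \<zero> \<Longrightarrow> s \<odot>\<^bsub>N\<^esub> y = \<zero>\<^bsub>N\<^esub>"
  obtains z where "z \<in> carrier N" "x \<odot>\<^bsub>N\<^esub> z = y"
    "\<And>s. s \<in> carrier R \<Longrightarrow> s \<otimes> x = \<zero> \<Longrightarrow> \<pi> s = \<zero> \<Longrightarrow> s \<odot>\<^bsub>N\<^esub> z = \<zero>\<^bsub>N\<^esub>"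
proof -
  interpret module R M by fact
  interpret N: module R N by fact
  interpret P: module R "res_mod R M (Suc k)" by (rule res_mod_module)
  interpret P2: module R "res_mod R M (Suc (Suc k))" by (rule res_mod_module)
  let ?P = "res_mod R M" and ?d = "res_diff R"
  obtain g where g: "g \<in> module_hom R (?P (Suc k)) (regular_module R)"
    and gd: "\<And>v. v \<in> carrier (?P (Suc (Suc k))) \<Longrightarrow> g (?d v) \<in> carrier R \<and> g (?d v) \<otimes> x = \<zero>"
    and gp: "g p \<in> carrier R" "g p \<otimes> x = x"
    and xp: "x \<odot>\<^bsub>?P (Suc k)\<^esub> p \<in> ?d ` carrier (?P (Suc (Suc k)))"
    using syzygy_functional_lift[OF M h] by blast
  have pc: "p \<in> carrier (?P (Suc k))" using h unfolding syzygy_functional_def by auto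
  have dc: "v \<in> carrier (?P (Suc n)) \<Longrightarrow> ?d v \<in> carrier (?P n)" for v n
    using res_exact(4)[of n] by (auto dest: module_hom_closed)
  interpret D: mod_hom R "?P (Suc (Suc k))" "?P (Suc k)" ?d
    by unfold_locales (rule res_exact)
  \<comment> \<open>\<open>\<phi>\<close> is \<open>\<pi>\<close> followed by the map sending \<open>t \<otimes> x\<close> to \<open>t \<odot> y\<close>.\<close>
  define \<phi> where "\<phi> s = (SOME t. t \<in> carrier R \<and> \<pi> s = t \<otimes> x) \<odot>\<^bsub>N\<^esub> y" for s
  have \<phi>: "\<phi> s = t \<odot>\<^bsub>N\<^esub> y" if "t \<in> carrier R" "\<pi> s = t \<otimes> x" for s t
  proof -
    obtain u where u_def: "u = (SOME t. t \<in> carrier R \<and> \<pi> s = t \<otimes> x)" by simp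
    have "u \<in> carrier R \<and> \<pi> s = u \<otimes> x"
      unfolding u_def by (rule someI[of _ t]) (simp add: that)
    then have u: "u \<in> carrier R" "\<pi> s = u \<otimes> x" "\<phi> s = u \<odot>\<^bsub>N\<^esub> y"
      unfolding \<phi>_def u_def by auto
    \<comment> \<open>Two coefficients of the same multiple of \<open>x\<close> differ by an
      annihilator of \<open>x\<close>, which kills \<open>y\<close> by assumption; so the choice in
      \<open>\<phi>\<close> is harmless.\<close>
    have "(u \<ominus> t) \<otimes> x = u \<otimes> x \<ominus> t \<otimes> x" using u(1) that(1) x_closed by algebra
    then have "(u \<ominus> t) \<otimes> x = \<zero>" using u that by simp
    then have "(u \<ominus> t) \<odot>\<^bsub>N\<^esub> y = \<zero>\<^bsub>N\<^esub>" using y(2) u(1) that(1) by simp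
    moreover have "u = (u \<ominus> t) \<oplus> t" using u(1) that(1) by algebra
    ultimately have "u \<odot>\<^bsub>N\<^esub> y = t \<odot>\<^bsub>N\<^esub> y"
      using N.smult_l_distr[of "u \<ominus> t" t y] u(1) that(1) y(1) by simp
    with u(3) show ?thesis by simp
  qed
  define f where "f v = \<phi> (g (?d v))" for v
  have f: "f \<in> module_hom R (?P (Suc (Suc k))) N"
    unfolding module_hom_def
  proof (intro CollectI conjI allI impI funcsetI; (elim conjE)?)
    fix v assume "v \<in> carrier (?P (Suc (Suc k)))"
    then obtain t where "t \<in> carrier R" "\<pi> (g (?d v)) = t \<otimes> x" using gd proj_multiple by blast
    then show "f v \<in> carrier N" unfolding f_def using \<phi> y(1) by simp
  next
    fix v w assume v: "v \<in> carrier (?P (Suc (Suc k)))" "w \<in> carrier (?P (Suc (Suc k)))"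
    obtain t where t: "t \<in> carrier R" "\<pi> (g (?d v)) = t \<otimes> x" using v gd proj_multiple by blast
    obtain u where u: "u \<in> carrier R" "\<pi> (g (?d w)) = u \<otimes> x" using v gd proj_multiple by blast
    have "g (?d (v \<oplus>\<^bsub>?P (Suc (Suc k))\<^esub> w)) = g (?d v) \<oplus> g (?d w)"
      using module_hom_add[OF g dc dc] v by (simp only: D.f_add regular_module_simps)
    then have "\<pi> (g (?d (v \<oplus>\<^bsub>?P (Suc (Suc k))\<^esub> w))) = (t \<oplus> u) \<otimes> x"
      using gd v proj_add t u by (simp add: l_distr)
    from \<phi>[OF _ this] \<phi>[OF t] \<phi>[OF u] show "f (v \<oplus>\<^bsub>?P (Suc (Suc k))\<^esub> w) = f v \<oplus>\<^bsub>N\<^esub> f w"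
      unfolding f_def using t u y(1) by (simp add: N.smult_l_distr)
  next
    fix r v assume v: "r \<in> carrier R" "v \<in> carrier (?P (Suc (Suc k)))"
    obtain t where t: "t \<in> carrier R" "\<pi> (g (?d v)) = t \<otimes> x" using v gd proj_multiple by blast
    have "g (?d (r \<odot>\<^bsub>?P (Suc (Suc k))\<^esub> v)) = r \<otimes> g (?d v)"
      using module_hom_smult[OF g _ dc] v by (simp only: D.f_smult regular_module_simps)
    then have "\<pi> (g (?d (r \<odot>\<^bsub>?P (Suc (Suc k))\<^esub> v))) = (r \<otimes> t) \<otimes> x"
      using gd v proj_mult t by (simp add: m_assoc)
    from \<phi>[OF _ this] \<phi>[OF t] show "f (r \<odot>\<^bsub>?P (Suc (Suc k))\<^esub> v) = r \<odot>\<^bsub>N\<^esub> f v"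
      unfolding f_def using t v y(1) by (simp add: N.smult_assoc1)
  qed
  have g0: "g \<zero>\<^bsub>?P (Suc k)\<^esub> = \<zero>"
    using module_hom_zero[OF P.module_axioms regular_module_module[OF is_cring] g] by simp
  have "\<pi> \<zero> = \<zero>" using proj_mult[of \<zero> \<zero>] proj_closed[of \<zero>] by simp
  then have \<phi>0: "\<phi> \<zero> = \<zero>\<^bsub>N\<^esub>" using \<phi>[of \<zero> \<zero>] y(1) by simp
  have "f (?d v) = \<zero>\<^bsub>N\<^esub>" if v: "v \<in> carrier (?P (Suc (Suc (Suc k))))" for v
  proof -
    have "?d (?d v) = \<zero>\<^bsub>?P (Suc k)\<^esub>" using res_exact(6)[of "Suc k"] v by blast
    then show ?thesis unfolding f_def using g0 \<phi>0 by simp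
  qed
  from Ext_trivial_extend[OF N ext f this] obtain G where
    G: "G \<in> module_hom R (?P (Suc k)) N" "\<And>v. v \<in> carrier (?P (Suc (Suc k))) \<Longrightarrow> G (?d v) = f v" by blast
  have Gd: "G w = \<phi> (g w)" if "w \<in> ?d ` carrier (?P (Suc (Suc k)))" for w
    using that G(2) unfolding f_def by auto
  show thesis
  proof (rule that)
    show "G p \<in> carrier N" using module_hom_closed[OF G(1)] pc by blast
    have "g (x \<odot>\<^bsub>?P (Suc k)\<^esub> p) = x"
      using module_hom_smult[OF g x_closed pc] gp by (simp add: m_comm)
    moreover have "\<phi> x = y" using \<phi>[of \<one> x] y(1) proj_x by simp
    ultimately show "x \<odot>\<^bsub>N\<^esub> G p = y"
      using module_hom_smult[OF G(1) x_closed pc] Gd[OF xp] by simp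
  next
    fix s assume s: "s \<in> carrier R" "s \<otimes> x = \<zero>" "\<pi> s = \<zero>"
    have "?d (s \<odot>\<^bsub>?P (Suc k)\<^esub> p) = \<zero>\<^bsub>?P k\<^esub>"
      using module_hom_smult[OF res_exact(4) s(1) pc] ann[OF s(1,2)] by simp
    then have "s \<odot>\<^bsub>?P (Suc k)\<^esub> p \<in> ?d ` carrier (?P (Suc (Suc k)))"
      unfolding res_exact(6) using P.smult_closed[OF s(1) pc] by blast
    from Gd[OF this] have "s \<odot>\<^bsub>N\<^esub> G p = \<phi> (g p \<otimes> s)"
      using module_hom_smult[OF G(1) s(1) pc] module_hom_smult[OF g s(1) pc] gp s by (simp add: m_comm)
    also have "\<pi> (g p \<otimes> s) = \<zero> \<otimes> x" using proj_mult[OF s(1,2) gp(1)] s gp by simp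
    then have "\<phi> (g p \<otimes> s) = \<zero>\<^bsub>N\<^esub>" using \<phi>[of \<zero>] y(1) by simp
    finally show "s \<odot>\<^bsub>N\<^esub> G p = \<zero>\<^bsub>N\<^esub>" .
  qed
qed

section \<open>Minimal generators and the first syzygy\<close>

lemma minimal_generating_set:
  assumes "fin_gen_module R M"
  obtains B where "B \<subseteq> carrier M" "finite B" "module.span R M B = carrier M"
    "\<And>c b. c \<in> B \<rightarrow> carrier R \<Longrightarrow> module.lincomb M c B = \<zero>\<^bsub>M\<^esub> \<Longrightarrow> b \<in> B \<Longrightarrow> c b \<otimes> x = \<zero>"
proof -
  interpret module R M using assms by (simp add: fin_gen_module_def)
  let ?Q = "\<lambda>A. A \<subseteq> carrier M \<and> finite A \<and> span A = carrier M"
  \<comment> \<open>Minimality means least cardinality. A relation with a coefficient not killing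
    \<open>x\<close> has a unit coefficient by \<open>unit\<close>, and the corresponding generator
    could be dropped.\<close>
  obtain B where B: "?Q B" and min: "\<And>A. ?Q A \<Longrightarrow> card B \<le> card A"
  proof -
    obtain A where "?Q A" using assms unfolding fin_gen_module_def by blast
    from ex_has_least_nat[of ?Q, OF this] show thesis using that by metis
  qed
  show thesis
  proof (rule that)
    fix c b assume c: "c \<in> B \<rightarrow> carrier R" "lincomb c B = \<zero>\<^bsub>M\<^esub>" and b: "b \<in> B"
    show "c b \<otimes> x = \<zero>"
    proof (rule ccontr)
      assume "c b \<otimes> x \<noteq> \<zero>"
      then have u: "c b \<in> Units R" using unit c(1) b by blast
      let ?B = "B - {b}"
      have sub: "?B \<subseteq> carrier M" and cb: "b \<in> carrier M" and cc: "c \<in> ?B \<rightarrow> carrier R"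
        and cbc: "c b \<odot>\<^bsub>M\<^esub> b \<in> carrier M"
        using B b c(1) by auto
      have l: "lincomb c ?B \<in> carrier M" using sub cc by simp
      have "lincomb c B = lincomb c ?B \<oplus>\<^bsub>M\<^esub> c b \<odot>\<^bsub>M\<^esub> b"
        using lincomb_del2[of B c b] B b c(1) l cbc M.a_comm by simp
      then have "c b \<odot>\<^bsub>M\<^esub> b = \<ominus>\<^bsub>M\<^esub> lincomb c ?B"
        using c(2) l cbc M.minus_equality[of "c b \<odot>\<^bsub>M\<^esub> b" "lincomb c ?B"] M.a_comm by simp
      moreover have "inv (c b) \<odot>\<^bsub>M\<^esub> (c b \<odot>\<^bsub>M\<^esub> b) = b"
        using smult_assoc1[of "inv (c b)" "c b" b] u cb Units_closed Units_inv_closed Units_l_inv by simp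
      ultimately have eq: "b = inv (c b) \<odot>\<^bsub>M\<^esub> (\<ominus>\<^bsub>M\<^esub> lincomb c ?B)" by simp
      interpret Sp: submodule R "span ?B" M by (rule span_is_submodule[OF sub])
      have "lincomb c ?B \<in> span ?B" unfolding span_def using B cc by auto
      then have "\<ominus>\<^bsub>M\<^esub> lincomb c ?B \<in> span ?B"
        using Sp.smult_closed[of "\<ominus> \<one>" "lincomb c ?B"] l by (simp add: smult_l_minus)
      then have "b \<in> span ?B" by (subst eq) (use u in auto)
      then have "B \<subseteq> span ?B" using in_own_span[OF sub] by blast
      then have "span B \<subseteq> span ?B" by (rule span_is_subset) (rule Sp.submodule_axioms)
      then have "?Q ?B" using B sub span_is_subset2[OF sub] by auto
      then have "card B \<le> card ?B" by (rule min)
      then show False using B b by (meson card_Diff1_less not_le)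
    qed
  qed (use B in auto)
qed

text \<open>The kernel \<open>U\<close> of the cover by a minimal generating set is nonzero as
  \<open>M\<close> is not free. Some coordinate maps \<open>U\<close> onto a nonzero ideal, and
  \<open>ideal_functional\<close> on that ideal gives a functional on \<open>U\<close>. The rest
  carries it over to the standard resolution.\<close>

lemma syzygy_functional_ex:
  fixes M :: "('a, 'm, 'd) module_scheme"
  assumes fg: "fin_gen_module R M" and nf: "\<not> free_module R M"
  obtains h p where "syzygy_functional M 0 h p"
proof -
  interpret module R M using fg by (simp add: fin_gen_module_def)
  interpret F0: module R "res_mod R M 0" by (rule res_mod_module)
  note free_on_simps [simp]
  let ?P = "res_mod R M" and ?d = "res_diff R"
  obtain B where B: "B \<subseteq> carrier M" "finite B" "span B = carrier M"
    and min: "\<And>c b. c \<in> B \<rightarrow> carrier R \<Longrightarrow> lincomb c B = \<zero>\<^bsub>M\<^esub> \<Longrightarrow> b \<in> B \<Longrightarrow> c b \<otimes> x = \<zero>"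
    using minimal_generating_set[OF fg] by blast
  let ?X = "Gen ` B :: ('a, 'm) res_basis set"
  let ?F = "free_on R ?X" and ?aug = "res_aug R M"
  interpret F: module R ?F by (rule free_on_module[OF is_cring])
  have "?X \<subseteq> Gen ` carrier M" using B(1) by (rule image_mono)
  then have FP: "carrier ?F \<subseteq> carrier (?P 0)" by (auto simp: res_mod_def free_on_def)
  have augh: "?aug \<in> module_hom R (?P 0) M" by (rule res_exact)
  have aug: "?aug f = lincomb (\<lambda>m. f (Gen m)) B" if f: "f \<in> carrier ?F" for f
  proof -
    have c: "f b \<in> carrier R" for b using f by (auto simp: free_on_def)
    have "?aug f = (\<Oplus>\<^bsub>M\<^esub>b\<in>?X. f b \<odot>\<^bsub>M\<^esub> gen_elem b)"
      unfolding res_aug_def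
      by (rule lin_ext_superset[OF f]) (use B f in \<open>auto simp: free_on_def\<close>)
    also have "\<dots> = lincomb (\<lambda>m. f (Gen m)) B"
      unfolding lincomb_def
      by (subst M.add.finprod_reindex) (use B c in \<open>auto simp: inj_on_def\<close>)
    finally show ?thesis .
  qed
  define vec :: "('m \<Rightarrow> 'a) \<Rightarrow> ('a, 'm) res_basis \<Rightarrow> 'a" where
    "vec c b = (if b \<in> ?X then c (gen_elem b) else \<zero>)" for c b
  have vecF: "vec c \<in> carrier ?F" if "c \<in> B \<rightarrow> carrier R" for c
  proof -
    have "{b. vec c b \<noteq> \<zero>} \<subseteq> ?X" by (auto simp: vec_def)
    moreover have "finite ?X" using B by simp
    ultimately show ?thesis using that by (auto simp: free_on_def vec_def finite_subset)
  qed
  have augvec: "?aug (vec c) = lincomb c B" if c: "c \<in> B \<rightarrow> carrier R" for c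
    unfolding aug[OF vecF[OF c]]
    by (rule lincomb_cong) (use c B in \<open>auto simp: vec_def\<close>)
  define U where "U = {f \<in> carrier ?F. ?aug f = \<zero>\<^bsub>M\<^esub>}"
  \<comment> \<open>Minimality of \<open>B\<close> enters here; this later gives the clause that
    \<open>x\<close> kills \<open>res_diff R p\<close>.\<close>
  have Ux: "f b \<otimes> x = \<zero>" if "f \<in> U" for f b
  proof (cases "b \<in> ?X")
    case True
    have "(\<lambda>m. f (Gen m)) \<in> B \<rightarrow> carrier R" "lincomb (\<lambda>m. f (Gen m)) B = \<zero>\<^bsub>M\<^esub>"
      using that aug by (auto simp: U_def free_on_def)
    from min[OF this] True show ?thesis by auto
  next
    case False
    then have "f b = \<zero>" using that by (auto simp: U_def free_on_def)
    then show ?thesis by simp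
  qed
  \<comment> \<open>As \<open>M\<close> is not free, the generating set \<open>B\<close> is
    dependent; \<open>b0\<close> is the coordinate in which a relation is nonzero.\<close>
  obtain c b0 where c: "c \<in> B \<rightarrow> carrier R" "lincomb c B = \<zero>\<^bsub>M\<^esub>" "b0 \<in> B" "c b0 \<noteq> \<zero>"
    using finite_lin_dep[OF B(2) _ B(1)] nf B module_axioms unfolding free_module_def by blast
  let ?g0 = "Gen b0 :: ('a, 'm) res_basis"
  have U0: "(\<lambda>_. \<zero>) \<in> U"
    using F.M.zero_closed module_hom_zero[OF F0.module_axioms module_axioms augh] by (simp add: U_def)
  have Uadd: "(\<lambda>b. f b \<oplus> g b) \<in> U" if "f \<in> U" "g \<in> U" for f g
    using that FP F.M.add.m_closed[of f g] module_hom_add[OF augh, of f g] by (auto simp: U_def)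
  have Umult: "(\<lambda>b. r \<otimes> f b) \<in> U" if "f \<in> U" "r \<in> carrier R" for f r
    using that FP F.smult_closed[of r f] module_hom_smult[OF augh, of r f] by (auto simp: U_def)
  let ?I = "(\<lambda>f. f ?g0) ` U"
  have I: "ideal ?I R"
  proof (rule ideal_criterion)
    show "?I \<subseteq> carrier R" by (auto simp: U_def free_on_def)
    show "\<zero> \<in> ?I" using U0 by (auto intro: rev_image_eqI)
    show "a \<oplus> b \<in> ?I" if "a \<in> ?I" "b \<in> ?I" for a b
      using that Uadd by (auto intro: rev_image_eqI)
    show "r \<otimes> a \<in> ?I" if "r \<in> carrier R" "a \<in> ?I" for r a
      using that Umult by (auto intro: rev_image_eqI)
  qed
  have "vec c \<in> U" using vecF augvec c by (simp add: U_def)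
  moreover have "vec c ?g0 \<noteq> \<zero>" using c by (simp add: vec_def)
  ultimately have "?I \<noteq> {\<zero>}" by blast
  from ideal_functional[OF I this] obtain \<theta> where
    \<theta>: "\<And>s. s \<in> ?I \<Longrightarrow> \<exists>t\<in>carrier R. \<theta> s = t \<otimes> x"
      "\<And>s t. s \<in> ?I \<Longrightarrow> t \<in> ?I \<Longrightarrow> \<theta> (s \<oplus> t) = \<theta> s \<oplus> \<theta> t"
      "\<And>s t. s \<in> ?I \<Longrightarrow> t \<in> carrier R \<Longrightarrow> \<theta> (t \<otimes> s) = t \<otimes> \<theta> s"
      "x \<in> \<theta> ` ?I" by blast
  from \<theta>(4) obtain u where u: "u \<in> U" "\<theta> (u ?g0) = x" by auto
  \<comment> \<open>Each \<open>m\<close> gets a preimage in the minimal cover. Taking the basis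
    vector itself for \<open>m \<in> B\<close> makes the induced map the identity on
    \<open>?F\<close>.\<close>
  have "\<exists>r. r \<in> carrier ?F \<and> ?aug r = m \<and> (m \<in> B \<longrightarrow> r = unit_vec_on R (Gen m))" if m: "m \<in> carrier M" for m
  proof (cases "m \<in> B")
    case True
    then have "unit_vec_on R (Gen m) \<in> carrier ?F" by (intro unit_vec_on_carrier) simp
    moreover have "?aug (unit_vec_on R (Gen m)) = m"
      unfolding res_aug_def by (subst lin_ext_unit_vec) (use m in auto)
    ultimately show ?thesis by blast
  next
    case False
    obtain c where "c \<in> B \<rightarrow> carrier R" "lincomb c B = m"
      using finite_in_span[OF B(2,1)] m B(3) by auto
    with vecF augvec False show ?thesis by blast
  qed
  then obtain r where r: "\<And>m. m \<in> carrier M \<Longrightarrow> r m \<in> carrier ?F"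
    "\<And>m. m \<in> carrier M \<Longrightarrow> ?aug (r m) = m" "\<And>m. m \<in> B \<Longrightarrow> r m = unit_vec_on R (Gen m)"
    using B(1) by (metis subsetD)
  have P0: "?P 0 = free_on R (Gen ` carrier M)" by (simp add: res_mod_def)
  \<comment> \<open>\<open>\<rho>\<close> retracts the standard cover onto the minimal one over \<open>M\<close>, so a functional on \<open>U\<close> extends to the
    standard first syzygy.\<close>
  obtain \<rho> where \<rho>: "\<rho> \<in> module_hom R (?P 0) ?F"
    "\<And>m. m \<in> carrier M \<Longrightarrow> \<rho> (unit_vec_on R (Gen m)) = r m"
  proof -
    have "(\<lambda>b. r (gen_elem b)) \<in> Gen ` carrier M \<rightarrow> carrier ?F" using r(1) by auto
    then obtain \<rho> where \<rho>: "\<rho> \<in> module_hom R (?P 0) ?F"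
      "\<And>b. b \<in> Gen ` carrier M \<Longrightarrow> \<rho> (unit_vec_on R b) = r (gen_elem b)"
      unfolding P0 by (rule F.free_on_hom_ex) blast
    from \<rho>(2)[OF imageI] show thesis by (intro that[OF \<rho>(1)]) simp
  qed
  have \<rho>c: "\<rho> v \<in> carrier ?F" if "v \<in> carrier (?P 0)" for v
    using module_hom_closed[OF \<rho>(1)] that by blast
  \<comment> \<open>Compatibility with the augmentations, checked on the basis, makes
    \<open>\<rho>\<close> map the standard first syzygy into \<open>U\<close>.\<close>
  have aug\<rho>: "?aug (\<rho> v) = ?aug v" if v: "v \<in> carrier (?P 0)" for v
  proof (rule free_on_hom_eqI[where g = "\<lambda>v. ?aug (\<rho> v)" and h = ?aug])
    show "(\<lambda>v. ?aug (\<rho> v)) \<in> module_hom R (free_on R (Gen ` carrier M)) M"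
      using \<rho>(1) augh FP unfolding P0 module_hom_def by (auto simp: Pi_iff subset_iff)
    show "?aug \<in> module_hom R (free_on R (Gen ` carrier M)) M" using augh unfolding P0 .
    fix b :: "('a, 'm) res_basis" assume "b \<in> Gen ` carrier M"
    then obtain m where m: "m \<in> carrier M" "b = Gen m" by blast
    have "?aug (unit_vec_on R (Gen m)) = m"
      unfolding res_aug_def by (subst lin_ext_unit_vec) (use m in auto)
    with m show "?aug (\<rho> (unit_vec_on R b)) = ?aug (unit_vec_on R b)" using \<rho>(2) r(2) by simp
  qed (use v P0 in simp)
  have \<rho>id: "\<rho> v = v" if v: "v \<in> carrier ?F" for v
  proof (rule F.free_on_hom_eqI[where g = \<rho> and h = "\<lambda>v. v"])
    show "\<rho> \<in> module_hom R ?F ?F"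
      using \<rho>(1) FP unfolding module_hom_def by (auto simp: Pi_iff subset_iff)
    show "(\<lambda>v. v) \<in> module_hom R ?F ?F" by (auto simp: module_hom_def)
    show "\<rho> (unit_vec_on R b) = unit_vec_on R b" if "b \<in> ?X" for b
      using that \<rho>(2) r(3) B(1) by auto
  qed (rule v)
  have dk: "?d v \<in> carrier (?P 0)" "?aug (?d v) = \<zero>\<^bsub>M\<^esub>" if "v \<in> carrier (?P 1)" for v
    using res_exact(5) that by blast+
  have \<rho>U: "\<rho> (?d v) \<in> U" if "v \<in> carrier (?P 1)" for v
    using \<rho>c aug\<rho> dk[OF that] by (simp add: U_def)
  define h where "h v = \<theta> (\<rho> (?d v) ?g0)" for v
  \<comment> \<open>An element of \<open>U\<close> is itself a standard first syzygy, and
    \<open>\<rho>\<close> fixes it, so \<open>h p = \<theta> (u ?g0) = x\<close>.\<close>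
  have "u \<in> ?d ` carrier (?P 1)" using res_exact(5) u(1) FP by (auto simp: U_def)
  then obtain p where p: "p \<in> carrier (?P 1)" "?d p = u" by blast
  have dh: "?d \<in> module_hom R (?P 1) (?P 0)" unfolding One_nat_def by (rule res_exact)
  have "syzygy_functional M 0 h p"
    unfolding syzygy_functional_def One_nat_def[symmetric]
  proof (intro conjI ballI)
    show "h \<in> module_hom R (?P 1) (regular_module R)"
      unfolding module_hom_def h_def
    proof (intro CollectI conjI allI impI funcsetI; (elim conjE)?)
      fix v assume "v \<in> carrier (?P 1)"
      then show "\<theta> (\<rho> (?d v) ?g0) \<in> carrier (regular_module R)"
        using \<theta>(1) \<rho>U x_closed by fastforce
    next
      fix v w assume v: "v \<in> carrier (?P 1)" "w \<in> carrier (?P 1)"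
      have "\<rho> (?d (v \<oplus>\<^bsub>?P 1\<^esub> w)) = \<rho> (?d v) \<oplus>\<^bsub>?F\<^esub> \<rho> (?d w)"
        using module_hom_add[OF \<rho>(1) dk(1) dk(1)] v by (simp only: module_hom_add[OF dh])
      then show "\<theta> (\<rho> (?d (v \<oplus>\<^bsub>?P 1\<^esub> w)) ?g0) = \<theta> (\<rho> (?d v) ?g0) \<oplus>\<^bsub>regular_module R\<^esub> \<theta> (\<rho> (?d w) ?g0)"
        using \<theta>(2) \<rho>U v by simp
    next
      fix s v assume v: "s \<in> carrier R" "v \<in> carrier (?P 1)"
      have "\<rho> (?d (s \<odot>\<^bsub>?P 1\<^esub> v)) = s \<odot>\<^bsub>?F\<^esub> \<rho> (?d v)"
        using module_hom_smult[OF \<rho>(1) _ dk(1)] v by (simp only: module_hom_smult[OF dh])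
      then show "\<theta> (\<rho> (?d (s \<odot>\<^bsub>?P 1\<^esub> v)) ?g0) = s \<odot>\<^bsub>regular_module R\<^esub> \<theta> (\<rho> (?d v) ?g0)"
        using \<theta>(3) \<rho>U v by simp
    qed
  next
    fix v assume "v \<in> carrier (?P (Suc 1))"
    then have "?d (?d v) = \<zero>\<^bsub>?P 0\<^esub>" using res_exact(6)[of 0] by (auto simp: numeral_2_eq_2)
    moreover have "\<rho> \<zero>\<^bsub>?P 0\<^esub> = \<zero>\<^bsub>?F\<^esub>" by (rule module_hom_zero[OF F0.module_axioms F.module_axioms \<rho>(1)])
    moreover have "\<zero> \<in> ?I" using U0 by (auto intro: rev_image_eqI)
    then have "\<theta> \<zero> \<in> carrier R" "\<theta> (\<zero> \<otimes> \<zero>) = \<zero> \<otimes> \<theta> \<zero>"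
      using \<theta>(1)[of \<zero>] \<theta>(3)[of \<zero> \<zero>] by auto
    then have "\<theta> \<zero> = \<zero>" by simp
    ultimately show "h (?d v) = \<zero>" by (simp add: h_def)
  next
    fix v assume "v \<in> carrier (?P 1)"
    then show "\<exists>t\<in>carrier R. h v = t \<otimes> x" unfolding h_def using \<theta>(1) \<rho>U by simp
  next
    show "p \<in> carrier (?P 1)" by (rule p)
    show "h p = x" using p u \<rho>id by (simp add: h_def U_def)
    have "u b \<in> carrier R" for b using u(1) by (auto simp: U_def free_on_def)
    then show "x \<odot>\<^bsub>?P 0\<^esub> ?d p = \<zero>\<^bsub>?P 0\<^esub>" using p(2) Ux[OF u(1)] by (simp add: fun_eq_iff m_comm)
  qed
  then show thesis by (rule that)
qed

text \<open>Only a functional produced by \<open>syzygy_functional_Suc\<close> comes with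
  annihilation by every \<open>s\<close> with \<open>s \<otimes> x = \<zero>\<close>. The base case
  therefore already performs one step, and the levels start at \<open>Suc 0\<close>.\<close>

lemma ex_syzygy_functional_annihilated:
  assumes fg: "fin_gen_module R M" and nf: "\<not> free_module R M"
  shows "\<exists>h p. syzygy_functional M (Suc k) h p \<and>
    (\<forall>s\<in>carrier R. s \<otimes> x = \<zero> \<longrightarrow>
      s \<odot>\<^bsub>res_mod R M (Suc k)\<^esub> res_diff R p = \<zero>\<^bsub>res_mod R M (Suc k)\<^esub>)"
proof -
  have M: "module R M" using fg by (simp add: fin_gen_module_def)
  have step: "\<exists>h p. syzygy_functional M (Suc k) h p \<and>
    (\<forall>s\<in>carrier R. s \<otimes> x = \<zero> \<longrightarrow>
      s \<odot>\<^bsub>res_mod R M (Suc k)\<^esub> res_diff R p = \<zero>\<^bsub>res_mod R M (Suc k)\<^esub>)"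
    if "syzygy_functional M k h p" for k h p
    by (rule syzygy_functional_Suc[OF M that]) blast
  show ?thesis
  proof (induction k)
    case 0
    show ?case by (rule syzygy_functional_ex[OF fg nf]) (rule step)
  next
    case (Suc k)
    then show ?case using step by blast
  qed
qed

section \<open>Freeness\<close>

text \<open>From \<open>x \<otimes> z = x\<close> it follows that \<open>z\<close> is a unit. The
  difference of \<open>s\<close> and \<open>\<pi> s\<close> is in the kernel of
  \<open>\<pi>\<close>, so \<open>z\<close> kills it and it is zero; thus
  \<open>s = \<pi> s\<close>.\<close>

lemma annihilator_eq_multiples:
  assumes z: "z \<in> carrier R" "x \<otimes> z = x"
    and van: "\<And>s. s \<in> carrier R \<Longrightarrow> s \<otimes> x = \<zero> \<Longrightarrow> \<pi> s = \<zero> \<Longrightarrow> s \<otimes> z = \<zero>"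
    and s: "s \<in> carrier R" "s \<otimes> x = \<zero>"
  shows "\<exists>t\<in>carrier R. s = t \<otimes> x"
proof -
  have "z \<otimes> x \<noteq> \<zero>" using z x_nonzero by (simp add: m_comm)
  then have zu: "z \<in> Units R" using unit z by blast
  obtain t where t: "t \<in> carrier R" "\<pi> s = t \<otimes> x" using proj_multiple s by blast
  let ?m = "(\<ominus> t) \<otimes> x"
  have m: "?m \<in> carrier R" "?m \<otimes> x = \<zero>" using t(1) x_square by (simp_all add: m_assoc)
  have "\<pi> ?m = ?m" using proj_mult[OF x_closed x_square, of "\<ominus> t"] t(1) by (simp add: proj_x)
  then have "\<pi> (s \<oplus> ?m) = \<zero>" using proj_add[OF s m] t by (simp add: l_minus r_neg)
  moreover have "(s \<oplus> ?m) \<otimes> x = \<zero>" using s m by (simp add: l_distr)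
  ultimately have "(s \<oplus> ?m) \<otimes> z = \<zero>" using van s(1) m(1) by simp
  then have "(s \<oplus> ?m) \<otimes> z \<otimes> inv z = \<zero>" using zu by simp
  then have "s \<oplus> ?m = \<zero>" using zu z(1) s(1) m(1) by (simp add: m_assoc)
  then have "s = t \<otimes> x" using s(1) t(1) by (simp add: l_minus minus_eq[symmetric])
  with t(1) show ?thesis by blast
qed

text \<open>The coefficients of a relation \<open>c\<close> on a minimal generating set have the
  form \<open>c b = x \<otimes> t b\<close>. Then \<open>x\<close> kills \<open>lincomb t B\<close>,
  which is therefore \<open>x\<close> times some \<open>lincomb r B\<close>. So
  \<open>t b \<ominus> x \<otimes> r b\<close> are the coefficients of another relation and kill
  \<open>x\<close>; with \<open>x \<otimes> x = \<zero>\<close> this gives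
  \<open>c b = \<zero>\<close>.\<close>

lemma free_if_annihilator_divisible:
  assumes fg: "fin_gen_module R M"
    and ann: "\<And>s. s \<in> carrier R \<Longrightarrow> s \<otimes> x = \<zero> \<Longrightarrow> \<exists>t\<in>carrier R. s = t \<otimes> x"
    and div: "\<And>u. u \<in> carrier M \<Longrightarrow> x \<odot>\<^bsub>M\<^esub> u = \<zero>\<^bsub>M\<^esub> \<Longrightarrow> \<exists>z\<in>carrier M. u = x \<odot>\<^bsub>M\<^esub> z"
  shows "free_module R M"
proof -
  interpret module R M using fg by (simp add: fin_gen_module_def)
  obtain B where B: "B \<subseteq> carrier M" "finite B" "span B = carrier M"
    and min: "\<And>c b. c \<in> B \<rightarrow> carrier R \<Longrightarrow> lincomb c B = \<zero>\<^bsub>M\<^esub> \<Longrightarrow> b \<in> B \<Longrightarrow> c b \<otimes> x = \<zero>"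
    using minimal_generating_set[OF fg] by blast
  have "lin_indpt B"
  proof (rule finite_lin_indpt2[OF B(2,1)], intro ballI)
    fix c b assume c: "c \<in> B \<rightarrow> carrier R" "lincomb c B = \<zero>\<^bsub>M\<^esub>" and b: "b \<in> B"
    have "\<forall>b\<in>B. \<exists>t\<in>carrier R. c b = x \<otimes> t"
    proof
      fix b assume b: "b \<in> B"
      then obtain t where "t \<in> carrier R" "c b = t \<otimes> x" using ann[of "c b"] min[OF c b] c(1) by blast
      then show "\<exists>t\<in>carrier R. c b = x \<otimes> t" using m_comm by auto
    qed
    then obtain t where t: "\<And>b. b \<in> B \<Longrightarrow> t b \<in> carrier R" "\<And>b. b \<in> B \<Longrightarrow> c b = x \<otimes> t b" by metis
    have tB: "t \<in> B \<rightarrow> carrier R" using t(1) by blast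
    have "lincomb c B = lincomb (\<lambda>b. x \<otimes> t b) B"
      by (rule lincomb_cong) (use B t in auto)
    also have "\<dots> = x \<odot>\<^bsub>M\<^esub> lincomb t B"
      by (rule lincomb_smult) (use B tB in auto)
    finally obtain z where z: "z \<in> carrier M" "lincomb t B = x \<odot>\<^bsub>M\<^esub> z"
      using div[of "lincomb t B"] c(2) B(1) tB by auto
    obtain r where r: "r \<in> B \<rightarrow> carrier R" "lincomb r B = z"
      using finite_in_span[OF B(2,1), of z] z(1) B(3) by auto
    have xr: "(\<lambda>b. x \<otimes> r b) \<in> B \<rightarrow> carrier R" using r(1) by auto
    have "lincomb (\<lambda>b. x \<otimes> r b) B = x \<odot>\<^bsub>M\<^esub> z"
      unfolding r(2)[symmetric] by (rule lincomb_smult) (use B r in auto)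
    then have "lincomb (\<lambda>b. t b \<ominus> x \<otimes> r b) B = \<zero>\<^bsub>M\<^esub>"
      using lincomb_diff[OF B(2,1) tB xr] z by (simp add: M.r_neg a_minus_def)
    moreover have "(\<lambda>b. t b \<ominus> x \<otimes> r b) \<in> B \<rightarrow> carrier R" using t(1) xr by auto
    ultimately have "(t b \<ominus> x \<otimes> r b) \<otimes> x = \<zero>" using min b by blast
    moreover have "(t b \<ominus> x \<otimes> r b) \<otimes> x = x \<otimes> t b \<ominus> r b \<otimes> (x \<otimes> x)"
    proof -
      have "t b \<in> carrier R" "r b \<in> carrier R" using b t(1) r(1) by auto
      then show ?thesis using x_closed by algebra
    qed
    moreover have "r b \<in> carrier R" using b r(1) by blast
    ultimately show "c b = \<zero>" using t b x_square by (simp add: a_minus_def)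
  qed
  then show ?thesis unfolding free_module_def using B module_axioms by blast
qed

theorem free_if_Ext_trivial:
  assumes fg: "fin_gen_module R M" and i: "i \<ge> 3"
    and ext: "trivial_group (Ext R i M (direct_sum M (regular_module R)))"
  shows "free_module R M"
proof (rule ccontr)
  assume nf: "\<not> free_module R M"
  interpret module R M using fg by (simp add: fin_gen_module_def)
  interpret A: module R "regular_module R" by (rule regular_module_module[OF is_cring])
  let ?N = "direct_sum M (regular_module R)"
  have N: "module R ?N" by (rule direct_sum_is_module) unfold_locales
  \<comment> \<open>A functional at level \<open>Suc k\<close> calls for Ext in degree
    \<open>Suc (Suc (Suc k))\<close>, which is where the bound 3 comes from.\<close>
  obtain k where k: "i = Suc (Suc (Suc k))"
    using i by (metis add_2_eq_Suc' le_Suc_ex numeral_3_eq_3 plus_nat.simps(2) add.commute)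
  obtain h p where h: "syzygy_functional M (Suc k) h p"
    "\<And>s. s \<in> carrier R \<Longrightarrow> s \<otimes> x = \<zero> \<Longrightarrow>
      s \<odot>\<^bsub>res_mod R M (Suc k)\<^esub> res_diff R p = \<zero>\<^bsub>res_mod R M (Suc k)\<^esub>"
    using ex_syzygy_functional_annihilated[OF fg nf] by blast
  have div: "\<exists>a b. a \<in> carrier M \<and> b \<in> carrier R \<and> x \<odot>\<^bsub>M\<^esub> a = u \<and> x \<otimes> b = v \<and>
      (\<forall>s\<in>carrier R. s \<otimes> x = \<zero> \<longrightarrow> \<pi> s = \<zero> \<longrightarrow> s \<otimes> b = \<zero>)"
    if "u \<in> carrier M" "v \<in> carrier R"
      "\<And>s. s \<in> carrier R \<Longrightarrow> s \<otimes> x = \<zero> \<Longrightarrow> s \<odot>\<^bsub>M\<^esub> u = \<zero>\<^bsub>M\<^esub> \<and> s \<otimes> v = \<zero>" for u v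
  proof -
    have "(u, v) \<in> carrier ?N"
      "\<And>s. s \<in> carrier R \<Longrightarrow> s \<otimes> x = \<zero> \<Longrightarrow> s \<odot>\<^bsub>?N\<^esub> (u, v) = \<zero>\<^bsub>?N\<^esub>"
      using that by (auto simp: direct_sum_def)
    from socle_divisible_if_Ext_trivial[OF module_axioms N h ext[unfolded k] this]
    obtain z where z: "z \<in> carrier ?N" "x \<odot>\<^bsub>?N\<^esub> z = (u, v)"
      "\<And>s. s \<in> carrier R \<Longrightarrow> s \<otimes> x = \<zero> \<Longrightarrow> \<pi> s = \<zero> \<Longrightarrow> s \<odot>\<^bsub>?N\<^esub> z = \<zero>\<^bsub>?N\<^esub>" by blast
    then show ?thesis by (intro exI[of _ "fst z"] exI[of _ "snd z"]) (auto simp: direct_sum_def)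
  qed
  \<comment> \<open>The pair \<open>(\<zero>, x)\<close> is killed by the annihilator of
    \<open>x\<close>; its second component makes that annihilator the ideal generated by
    \<open>x\<close>.\<close>
  obtain b where b: "b \<in> carrier R" "x \<otimes> b = x"
    "\<And>s. s \<in> carrier R \<Longrightarrow> s \<otimes> x = \<zero> \<Longrightarrow> \<pi> s = \<zero> \<Longrightarrow> s \<otimes> b = \<zero>"
    using div[of "\<zero>\<^bsub>M\<^esub>" x] by auto
  have ann: "\<exists>t\<in>carrier R. s = t \<otimes> x" if "s \<in> carrier R" "s \<otimes> x = \<zero>" for s
    using annihilator_eq_multiples[OF b(1,2) _ that] b(3) by blast
  have "\<exists>z\<in>carrier M. u = x \<odot>\<^bsub>M\<^esub> z" if u: "u \<in> carrier M" "x \<odot>\<^bsub>M\<^esub> u = \<zero>\<^bsub>M\<^esub>" for u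
  proof -
    \<comment> \<open>By \<open>ann\<close> such an \<open>s\<close> is a multiple of
      \<open>x\<close>, so being killed by \<open>x\<close> already qualifies \<open>u\<close> for
      \<open>div\<close>.\<close>
    have "s \<odot>\<^bsub>M\<^esub> u = \<zero>\<^bsub>M\<^esub> \<and> s \<otimes> \<zero> = \<zero>" if "s \<in> carrier R" "s \<otimes> x = \<zero>" for s
      using ann[OF that] that u smult_assoc1[of _ x u] by fastforce
    moreover have "\<zero> \<in> carrier R" by simp
    ultimately show ?thesis using div[OF u(1)] by blast
  qed
  from free_if_annihilator_divisible[OF fg ann this] nf show False by blast
qed

end

theorem theorem3p7:
  fixes R :: "'a ring" and \<mm> :: "'a set"
    and M :: "('a \<times> 'a set, 'm) module" and i :: nat
  defines "S \<equiv> R \<ltimes> quotient_ring_module R \<mm>"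
  assumes "noetherian_local_ring R \<mm>"
    and "fin_gen_module S M"
    and "carrier M \<noteq> {\<zero>\<^bsub>M\<^esub>}"
    and "i \<ge> 3"
    and "trivial_group (Ext S i M (direct_sum M (regular_module S)))"
  shows "free_module S M"
  using split_socle.free_if_Ext_trivial[OF noetherian_local_ring.split_socle_residue_idealization]
    assms unfolding S_def by blast

end
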